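(* Let $\Theta\subset\mathbb{R}^{n_\theta}$, let $\theta\in\Theta$ be a random parameter with prior probability density $p_0$, let $U\in\mathbb{R}^{n_U}$ be a fixed design variable, and let $$Y=F(\theta,U)+Z\in\mathbb{R}^{n_Y},\qquad p(Z\mid\theta)=\mathcal{N}(Z,0,S(\theta,U)),$$ where $F$ and $S$ are smooth functions and $S(\theta,U)$ is symmetric positive definite for all $\theta\in\Theta$, $U\in\mathbb{R}^{n_U}$. Let $\hat\theta(Y,U)$ be any estimator of $\theta$ (any measurable $\mathbb{R}^{n_\theta}$-valued function of $Y$, for the given $U$; it may be biased). Then $$\mathbb{E}|\theta-\hat\theta(Y,U)|^2\;\geqslant\; n_\theta(2\pi e)^{-1}\,e^{2n_\theta^{-1}\left(H_\theta-I_{\theta;Y}(U)\right)}\;\geqslant\;\frac{n_\theta}{|J_P+J_D(U)|^{1/n_\theta}},$$ where $H_\theta$ is the differential entropy of $\theta$, $I_{\theta;Y}(U)$ is the mutual information between $\theta$ and $Y$, and $J_P$, $J_D(U)$ are the prior and data parts of the Bayesian information matrix. The second inequality is asserted under the regularity conditions, listed in the context, that make $J_P$ and $J_D(U)$ well defined.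
   Context: Notation: $|x|$ is the Euclidean norm of a vector $x$; $|M|$ is the determinant of a square matrix $M$; $\mathcal{N}(x,m,S)=(2\pi)^{-n/2}|S|^{-1/2}\exp\left(-\tfrac12(x-m)^{\mathsf T}S^{-1}(x-m)\right)$ is the Gaussian density on $\mathbb{R}^n$ with mean $m$ and covariance $S$. Expectations without subscript are with respect to the joint law of $(\theta,Y)$ given $U$. Densities: $p(Y\mid\theta,U)=\mathcal{N}(Y,F(\theta,U),S(\theta,U))$, $p(Y\mid U)=\int p_0(\theta)\,p(Y\mid\theta,U)\,d\theta$, $p(\theta\mid Y,U)=p_0(\theta)p(Y\mid\theta,U)/p(Y\mid U)$, $p(\theta,Y\mid U)=p_0(\theta)p(Y\mid\theta,U)$. Entropies: $H_\theta=\mathbb{E}(-\ln p_0(\theta))$, $H_Y(U)=\mathbb{E}(-\ln p(Y\mid U))$, $H_{Y\mid\theta}(U)=\mathbb{E}(-\ln p(Y\mid\theta,U))$, $H_{\theta\mid Y}(U)=\mathbb{E}(-\ln p(\theta\mid Y,U))$, all assumed to exist and be finite. Mutual information: $I_{\theta;Y}(U)=H_\theta-H_{\theta\mid Y}(U)=H_Y(U)-H_{Y\mid\theta}(U)$. Bayesian information: $$J_P=\mathbb{E}_{p_0(\theta)}\left[\nabla_\theta\ln p_0(\theta)\,(\nabla_\theta\ln p_0(\theta))^{\mathsf T}\right],\qquad J_D(U)=\mathbb{E}_{p(\theta,Y\mid U)}\left[\nabla_\theta\ln p(Y\mid\theta,U)\,(\nabla_\theta\ln p(Y\mid\theta,U))^{\mathsf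 T}\right].$$ Regularity conditions for the second inequality: the prior density $p_0$ and the joint density $p(\theta,Y\mid U)$ (extended by zero for $\theta\notin\Theta$) are differentiable with respect to $\theta$ on $\mathbb{R}^{n_\theta}$; $\int\nabla_\theta p(Y\mid\theta,U)\,dY=0$ for all $\theta\in\Theta$; and the expectations defining $J_P$ and $J_D(U)$ exist (are finite). *)

theory Defs
  imports "HOL-Probability.Probability"
begin

text \<open>For a Euclidean domain and open \<open>W\<close>, \<open>Ck_on k W f\<close> says that \<open>f\<close> is of class \<open>C\<^sup>k\<close> on \<open>W\<close>:
  all directional derivatives of a Frechet differentiable map are again of class \<open>C\<^sup>k\<^sup>-\<^sup>1\<close>.\<close>

primrec Ck_on ::
    "nat \<Rightarrow> 'a::euclidean_space set \<Rightarrow> ('a \<Rightarrow> 'b::real_normed_vector) \<Rightarrow> bool" where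
  "Ck_on 0 W f = continuous_on W f"
| "Ck_on (Suc k) W f =
     (\<exists>f'. (\<forall>x\<in>W. (f has_derivative f' x) (at x)) \<and> (\<forall>v. Ck_on k W (\<lambda>x. f' x v)))"

text \<open>Smoothness on a set that need not be open means smoothness on some open neighbourhood of it.\<close>

definition smooth_near :: "'a::euclidean_space set \<Rightarrow> ('a \<Rightarrow> 'b::real_normed_vector) \<Rightarrow> bool" where
  "smooth_near A f \<longleftrightarrow> (\<exists>W. open W \<and> A \<subseteq> W \<and> (\<forall>k. Ck_on k W f))"

definition sym_pos_def :: "real^'n^'n \<Rightarrow> bool" where
  "sym_pos_def A \<longleftrightarrow> transpose A = A \<and> (\<forall>x. x \<noteq> 0 \<longrightarrow> 0 < x \<bullet> (A *v x))"

definition gaussian_density :: "real^'n \<Rightarrow> real^'n \<Rightarrow> real^'n^'n \<Rightarrow> real" where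
  "gaussian_density x m S =
     (2 * pi) powr (- real CARD('n) / 2) * det S powr (- 1 / 2)
       * exp (- (1 / 2) * ((x - m) \<bullet> (matrix_inv S *v (x - m))))"

text \<open>Meaningful at points of differentiability only.\<close>

definition gradient :: "('a::real_inner \<Rightarrow> real) \<Rightarrow> 'a \<Rightarrow> 'a" where
  "gradient f x = (THE D. GDERIV f x :> D)"

definition outer_product :: "real^'n \<Rightarrow> real^'n \<Rightarrow> real^'n^'n" where
  "outer_product v w = (\<chi> i j. v $ i * w $ j)"

text \<open>In the following, \<open>p0\<close> is the prior density extended by zero outside the parameter set, so that
  integrals over the parameter set become integrals over the whole space. The arguments are named
  \<open>t\<close> (parameter), \<open>y\<close> (observation) and \<open>u\<close> (design).\<close>

definition likelihood ::
    "(real^'n \<Rightarrow> real^'k \<Rightarrow> real^'m) \<Rightarrow> (real^'n \<Rightarrow> real^'k \<Rightarrow> real^'m^'m) \<Rightarrow> real^'k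
      \<Rightarrow> real^'n \<Rightarrow> real^'m \<Rightarrow> real" where
  "likelihood F S u t y = gaussian_density y (F t u) (S t u)"

definition joint_density ::
    "(real^'n \<Rightarrow> real) \<Rightarrow> (real^'n \<Rightarrow> real^'k \<Rightarrow> real^'m) \<Rightarrow> (real^'n \<Rightarrow> real^'k \<Rightarrow> real^'m^'m)
      \<Rightarrow> real^'k \<Rightarrow> real^'n \<Rightarrow> real^'m \<Rightarrow> real" where
  "joint_density p0 F S u t y = p0 t * likelihood F S u t y"

definition evidence ::
    "(real^'n \<Rightarrow> real) \<Rightarrow> (real^'n \<Rightarrow> real^'k \<Rightarrow> real^'m) \<Rightarrow> (real^'n \<Rightarrow> real^'k \<Rightarrow> real^'m^'m)
      \<Rightarrow> real^'k \<Rightarrow> real^'m \<Rightarrow> real" where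
  "evidence p0 F S u y = (\<integral>t. p0 t * likelihood F S u t y \<partial>lborel)"

definition posterior ::
    "(real^'n \<Rightarrow> real) \<Rightarrow> (real^'n \<Rightarrow> real^'k \<Rightarrow> real^'m) \<Rightarrow> (real^'n \<Rightarrow> real^'k \<Rightarrow> real^'m^'m)
      \<Rightarrow> real^'k \<Rightarrow> real^'n \<Rightarrow> real^'m \<Rightarrow> real" where
  "posterior p0 F S u t y = p0 t * likelihood F S u t y / evidence p0 F S u y"

text \<open>The entropies are expectations over the probability space \<open>M\<close> carrying the parameter
  \<open>\<theta>\<close> and the observation \<open>Y\<close>.\<close>

definition prior_entropy :: "'a measure \<Rightarrow> ('a \<Rightarrow> real^'n) \<Rightarrow> (real^'n \<Rightarrow> real) \<Rightarrow> real" where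
  "prior_entropy M \<theta> p0 = (\<integral>\<omega>. - ln (p0 (\<theta> \<omega>)) \<partial>M)"

definition posterior_entropy ::
    "'a measure \<Rightarrow> ('a \<Rightarrow> real^'n) \<Rightarrow> ('a \<Rightarrow> real^'m) \<Rightarrow> (real^'n \<Rightarrow> real)
      \<Rightarrow> (real^'n \<Rightarrow> real^'k \<Rightarrow> real^'m) \<Rightarrow> (real^'n \<Rightarrow> real^'k \<Rightarrow> real^'m^'m) \<Rightarrow> real^'k \<Rightarrow> real" where
  "posterior_entropy M \<theta> Y p0 F S u = (\<integral>\<omega>. - ln (posterior p0 F S u (\<theta> \<omega>) (Y \<omega>)) \<partial>M)"

definition finite_entropies ::
    "'a measure \<Rightarrow> ('a \<Rightarrow> real^'n) \<Rightarrow> ('a \<Rightarrow> real^'m) \<Rightarrow> (real^'n \<Rightarrow> real)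
      \<Rightarrow> (real^'n \<Rightarrow> real^'k \<Rightarrow> real^'m) \<Rightarrow> (real^'n \<Rightarrow> real^'k \<Rightarrow> real^'m^'m) \<Rightarrow> real^'k \<Rightarrow> bool" where
  "finite_entropies M \<theta> Y p0 F S u \<longleftrightarrow>
     integrable M (\<lambda>\<omega>. - ln (p0 (\<theta> \<omega>)))
   \<and> integrable M (\<lambda>\<omega>. - ln (evidence p0 F S u (Y \<omega>)))
   \<and> integrable M (\<lambda>\<omega>. - ln (likelihood F S u (\<theta> \<omega>) (Y \<omega>)))
   \<and> integrable M (\<lambda>\<omega>. - ln (posterior p0 F S u (\<theta> \<omega>) (Y \<omega>)))"

definition mutual_info ::
    "'a measure \<Rightarrow> ('a \<Rightarrow> real^'n) \<Rightarrow> ('a \<Rightarrow> real^'m) \<Rightarrow> (real^'n \<Rightarrow> real)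
      \<Rightarrow> (real^'n \<Rightarrow> real^'k \<Rightarrow> real^'m) \<Rightarrow> (real^'n \<Rightarrow> real^'k \<Rightarrow> real^'m^'m) \<Rightarrow> real^'k \<Rightarrow> real" where
  "mutual_info M \<theta> Y p0 F S u = prior_entropy M \<theta> p0 - posterior_entropy M \<theta> Y p0 F S u"

definition prior_info_integrand :: "(real^'n \<Rightarrow> real) \<Rightarrow> real^'n \<Rightarrow> real^'n^'n" where
  "prior_info_integrand p0 t =
     p0 t *\<^sub>R outer_product (gradient (\<lambda>s. ln (p0 s)) t) (gradient (\<lambda>s. ln (p0 s)) t)"

definition prior_info :: "(real^'n \<Rightarrow> real) \<Rightarrow> real^'n^'n" where
  "prior_info p0 = (\<integral>t. prior_info_integrand p0 t \<partial>lborel)"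

definition data_info_integrand ::
    "(real^'n \<Rightarrow> real) \<Rightarrow> (real^'n \<Rightarrow> real^'k \<Rightarrow> real^'m) \<Rightarrow> (real^'n \<Rightarrow> real^'k \<Rightarrow> real^'m^'m)
      \<Rightarrow> real^'k \<Rightarrow> (real^'n) \<times> (real^'m) \<Rightarrow> real^'n^'n" where
  "data_info_integrand p0 F S u =
     (\<lambda>(t, y). joint_density p0 F S u t y *\<^sub>R
        outer_product (gradient (\<lambda>s. ln (likelihood F S u s y)) t)
                      (gradient (\<lambda>s. ln (likelihood F S u s y)) t))"

definition data_info ::
    "(real^'n \<Rightarrow> real) \<Rightarrow> (real^'n \<Rightarrow> real^'k \<Rightarrow> real^'m) \<Rightarrow> (real^'n \<Rightarrow> real^'k \<Rightarrow> real^'m^'m)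
      \<Rightarrow> real^'k \<Rightarrow> real^'n^'n" where
  "data_info p0 F S u = (\<integral>x. data_info_integrand p0 F S u x \<partial>(lborel \<Otimes>\<^sub>M lborel))"

text \<open>\<open>has_bochner_integral\<close> is used because an equation with the total integral operator would also
  hold for gradients that are not integrable.\<close>

definition information_regularity ::
    "(real^'n) set \<Rightarrow> (real^'n \<Rightarrow> real) \<Rightarrow> (real^'n \<Rightarrow> real^'k \<Rightarrow> real^'m)
      \<Rightarrow> (real^'n \<Rightarrow> real^'k \<Rightarrow> real^'m^'m) \<Rightarrow> real^'k \<Rightarrow> bool" where
  "information_regularity \<Theta> p0 F S u \<longleftrightarrow>
     (\<forall>t. p0 differentiable (at t))
   \<and> (\<forall>y t. (\<lambda>s. joint_density p0 F S u s y) differentiable (at t))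
   \<and> (\<forall>t\<in>\<Theta>. has_bochner_integral lborel (\<lambda>y. gradient (\<lambda>s. likelihood F S u s y) t) 0)
   \<and> integrable lborel (prior_info_integrand p0)
   \<and> integrable (lborel \<Otimes>\<^sub>M lborel) (data_info_integrand p0 F S u)"

end

theory Submission
  imports Defs
begin

text \<open>With \<open>h\<close> the posterior entropy, \<open>H - I = h\<close>, and the first inequality is Gibbs' inequality for the
  posterior against the Gaussian centred at the estimate.

  The second one amounts to \<open>h \<ge> n/2 ln (2 \<pi> e) - 1/2 ln det J\<close>, a Euclidean logarithmic Sobolev
  inequality averaged over the observations. In one dimension it follows by transporting a density \<open>g\<close> to
  the Gaussian by a monotone map \<open>T\<close>: the change of variables \<open>g = \<phi>(T) T'\<close>, the bound \<open>ln T' \<le> T' - 1\<close>,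
  and \<open>\<integral> g T' = - \<integral> g' T \<le> 1/2 \<integral> g'\<^sup>2 / g + 1/2 \<integral> g T\<^sup>2\<close>. It tensorises because the entropy of a vector is at
  least the sum of the entropies of its coordinates conditioned on all other coordinates. Applied in linear
  coordinates \<open>B\<close> with \<open>B\<^sup>T (J + \<epsilon>) B = 1\<close> it bounds \<open>det (J + \<epsilon>)\<close> from below uniformly in \<open>\<epsilon> > 0\<close>, which also
  gives \<open>det J > 0\<close>. That \<open>J\<close> is the information matrix of the joint density uses that the
  score of the likelihood has mean zero.\<close>

section \<open>Integration along lines\<close>

text \<open>The argument runs along lines in arbitrary directions of the ambient space because the
  coordinates \<open>B\<close> vary with \<epsilon>: no density is transformed and no conditional
  law is constructed. In one dimension, ln g = ln T' - T^2/2 - ln c for a Gaussian target with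
  normalising constant c. The term - T^2/2 cancels the half square left over by Young's inequality,
  so the second moment of the target is never computed. A direction with Fisher information at most
  1 then contributes at most 1/2 - 1 - ln (2 pi)/2 = - ln (2 pi e)/2, the origin of the constant.
  Integration by parts needs control of the boundary terms and of the integral of g T^2. Truncating
  the target to \<open>{-N..N}\<close> bounds T by N and gives both; N tends to infinity only after
  the directions have been summed. Densities may vanish and their derivatives may be discontinuous,
  but at a zero of a nonnegative differentiable density the derivative is 0 as well, so the
  convention 0/0 = 0 gives the right Fisher integrand.\<close>

definition line_integral :: "'e::euclidean_space \<Rightarrow> ('e \<Rightarrow> ennreal) \<Rightarrow> 'e \<Rightarrow> ennreal" where
  "line_integral d g x = (\<integral>\<^sup>+ s. g (x + s *\<^sub>R d) \<partial>(lborel :: real measure))"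

lemma borel_measurable_line_integral [measurable]:
  assumes [measurable]: "g \<in> borel_measurable borel"
  shows "line_integral d g \<in> borel_measurable borel"
  unfolding line_integral_def by measurable

text \<open>Because of this invariance a quantity attached to a line can be stored as a function of
  points, and no hyperplane transversal to \<open>d\<close> has to be parametrised.\<close>

lemma line_integral_shift:
  assumes [measurable]: "g \<in> borel_measurable borel"
  shows "line_integral d g (x + r *\<^sub>R d) = line_integral d g x"
proof -
  have "line_integral d g x = (\<integral>\<^sup>+ s. g (x + (r + 1 * s) *\<^sub>R d) \<partial>lborel)"
    unfolding line_integral_def
    by (subst nn_integral_real_affine[where c = 1 and t = r]) auto
  then show ?thesis
    by (simp add: line_integral_def algebra_simps)
qed

lemma line_integral_reflect:
  assumes [measurable]: "g \<in> borel_measurable borel"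
  shows "(\<integral>\<^sup>+ s. g (x - s *\<^sub>R d) \<partial>lborel) = line_integral d g x"
  unfolding line_integral_def
  by (subst nn_integral_real_affine[where c = "-1" and t = 0]) auto

lemma nn_integral_lborel_translate:
  fixes c :: "'e::euclidean_space"
  assumes [measurable]: "g \<in> borel_measurable borel"
  shows "(\<integral>\<^sup>+ x. g (x + c) \<partial>lborel) = (\<integral>\<^sup>+ x. g x \<partial>lborel)"
  by (subst (2) lborel_distr_plus[of c, symmetric]) (simp add: nn_integral_distr add.commute)

lemma AE_lborel_translate:
  fixes c :: "'e::euclidean_space"
  assumes "AE x in lborel. P x" and [measurable]: "Measurable.pred borel P"
  shows "AE x in lborel. P (x + c)"
proof -
  have "AE x in distr lborel borel ((+) c). P x"
    unfolding lborel_distr_plus by fact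
  then show ?thesis
    by (subst (asm) AE_distr_iff) (auto simp: add.commute)
qed

text \<open>Exchanging the two quantifiers leaves, for each fixed \<open>s\<close>, a translate of
  \<open>P\<close>, and null sets are translation invariant.\<close>

lemma AE_lines:
  fixes d :: "'e::euclidean_space"
  assumes P [measurable]: "Measurable.pred borel P"
  shows "(AE x in lborel. AE s in (lborel :: real measure). P (x + s *\<^sub>R d)) \<longleftrightarrow> (AE x in lborel. P x)"
proof -
  have m: "{p \<in> space ((lborel :: 'e measure) \<Otimes>\<^sub>M (lborel :: real measure)). P (fst p + snd p *\<^sub>R d)}
      \<in> sets (lborel \<Otimes>\<^sub>M lborel)"
    by measurable
  have c: "(AE x in lborel. AE s in (lborel :: real measure). P (x + s *\<^sub>R d)) \<longleftrightarrow>
      (AE s in (lborel :: real measure). AE x in lborel. P (x + s *\<^sub>R d))"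
    using lborel_pair.AE_commute[of "\<lambda>x s. P (x + s *\<^sub>R d)"] m by simp
  have iff: "(AE x in lborel. P (x + s *\<^sub>R d)) \<longleftrightarrow> (AE x in lborel. P x)" for s
  proof
    assume "AE x in lborel. P (x + s *\<^sub>R d)"
    then have "AE x in lborel. P (x + (- s *\<^sub>R d) + s *\<^sub>R d)"
      by (rule AE_lborel_translate) measurable
    then show "AE x in lborel. P x" by simp
  next
    assume "AE x in lborel. P x"
    then show "AE x in lborel. P (x + s *\<^sub>R d)"
      by (rule AE_lborel_translate) measurable
  qed
  have "\<not> (AE s in (lborel :: real measure). False)"
    by (simp add: trivial_limit_def[symmetric] ae_filter_eq_bot_iff)
  then show ?thesis
    unfolding c iff by (cases "AE x in lborel. P x") auto
qed

text \<open>Integration along \<open>d\<close> is self-adjoint: Tonelli, a translation for each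
  fixed \<open>s\<close>, and a reflection of the parameter.\<close>

lemma nn_integral_lines_swap:
  fixes d :: "'e::euclidean_space"
  assumes [measurable]: "q \<in> borel_measurable borel" "h \<in> borel_measurable borel"
  shows "(\<integral>\<^sup>+ x. q x * line_integral d h x \<partial>lborel) = (\<integral>\<^sup>+ x. line_integral d q x * h x \<partial>lborel)"
proof -
  have "(\<integral>\<^sup>+ x. q x * line_integral d h x \<partial>lborel)
      = (\<integral>\<^sup>+ x. (\<integral>\<^sup>+ s. q x * h (x + s *\<^sub>R d) \<partial>(lborel :: real measure)) \<partial>lborel)"
    by (simp add: line_integral_def nn_integral_cmult)
  also have "\<dots> = (\<integral>\<^sup>+ s. (\<integral>\<^sup>+ x. q x * h (x + s *\<^sub>R d) \<partial>lborel) \<partial>(lborel :: real measure))"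
    by (rule lborel_pair.Fubini'[symmetric]) measurable
  also have "\<dots> = (\<integral>\<^sup>+ s. (\<integral>\<^sup>+ x. q (x - s *\<^sub>R d) * h x \<partial>lborel) \<partial>(lborel :: real measure))"
  proof (rule nn_integral_cong)
    fix s :: real
    show "(\<integral>\<^sup>+ x. q x * h (x + s *\<^sub>R d) \<partial>lborel) = (\<integral>\<^sup>+ x. q (x - s *\<^sub>R d) * h x \<partial>lborel)"
      using nn_integral_lborel_translate[of "\<lambda>x. q (x - s *\<^sub>R d) * h x" "s *\<^sub>R d"] by simp
  qed
  also have "\<dots> = (\<integral>\<^sup>+ x. (\<integral>\<^sup>+ s. q (x - s *\<^sub>R d) * h x \<partial>(lborel :: real measure)) \<partial>lborel)"
    by (rule lborel_pair.Fubini') measurable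
  also have "\<dots> = (\<integral>\<^sup>+ x. line_integral d q x * h x \<partial>lborel)"
    by (simp add: nn_integral_multc line_integral_reflect)
  finally show ?thesis .
qed

lemma line_integral_divide_self:
  assumes [measurable]: "g \<in> borel_measurable borel"
  shows "line_integral d (\<lambda>x. g x / line_integral d g x) x = line_integral d g x / line_integral d g x"
proof -
  have "line_integral d (\<lambda>x. g x / line_integral d g x) x
      = (\<integral>\<^sup>+ s. g (x + s *\<^sub>R d) / line_integral d g x \<partial>lborel)"
    unfolding line_integral_def[of d "\<lambda>x. g x / line_integral d g x"]
    by (simp add: line_integral_shift)
  also have "\<dots> = line_integral d g x / line_integral d g x"
    by (simp add: nn_integral_divide) (simp add: line_integral_def)
  finally show ?thesis .
qed

text \<open>In \<open>ennreal\<close> both \<open>0 / 0\<close> and \<open>top / top\<close> are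
  \<open>0\<close>; the quotient is \<open>1\<close> for all other arguments.\<close>

lemma ennreal_divide_self_le_1: "x / x \<le> (1 :: ennreal)"
  by (cases "x = 0 \<or> x = top") (auto simp: less_top)

text \<open>Weighting each line with the normalised density \<open>f / line_integral d f\<close> recovers integrals
  over the whole space from integrals over lines.\<close>

lemma nn_integral_disintegrate:
  fixes d :: "'e::euclidean_space"
  assumes [measurable]: "h \<in> borel_measurable borel" "f \<in> borel_measurable borel"
    and supp: "\<And>x. h x \<noteq> 0 \<Longrightarrow> 0 < line_integral d f x \<and> line_integral d f x < top"
  shows "(\<integral>\<^sup>+ x. h x \<partial>lborel) = (\<integral>\<^sup>+ x. (f x / line_integral d f x) * line_integral d h x \<partial>lborel)"
  unfolding nn_integral_lines_swap[of "\<lambda>x. f x / line_integral d f x" h, simplified]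
  unfolding line_integral_divide_self[OF assms(2)]
proof (intro nn_integral_cong)
  fix x show "h x = line_integral d f x / line_integral d f x * h x"
    using supp[of x] by (cases "h x = 0") auto
qed

text \<open>Lines on which \<open>g\<close> has mass \<open>0\<close> or \<open>top\<close> receive
  weight \<open>0\<close> and can only lose mass of \<open>f\<close>. This bounds the expectation of
  the ratio \<open>r\<close> in \<open>log_ratio_lines_le\<close>.\<close>

lemma nn_integral_ratio_le:
  fixes d :: "'e::euclidean_space"
  assumes [measurable]: "g \<in> borel_measurable borel" "f \<in> borel_measurable borel"
  shows "(\<integral>\<^sup>+ x. (g x / line_integral d g x) * line_integral d f x \<partial>lborel) \<le> (\<integral>\<^sup>+ x. f x \<partial>lborel)"
  unfolding nn_integral_lines_swap[of "\<lambda>x. g x / line_integral d g x" f, simplified]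
  unfolding line_integral_divide_self[OF assms(1)]
  by (intro nn_integral_mono) (metis ennreal_divide_self_le_1 mult_left_mono mult_1 zero_le mult_right_mono)

lemma AE_line_integral_finite_imp:
  assumes [measurable]: "g \<in> borel_measurable borel"
    and "AE x in lborel. line_integral d g x < top"
  shows "AE x in lborel. g x < top"
proof -
  have "AE x in lborel. AE s in lborel. g (x + s *\<^sub>R d) < top"
    using assms(2)
  proof eventually_elim
    case (elim x)
    then have "(\<integral>\<^sup>+ s. g (x + s *\<^sub>R d) \<partial>lborel) \<noteq> \<infinity>"
      by (simp add: line_integral_def less_top)
    then have "AE s in lborel. g (x + s *\<^sub>R d) \<noteq> \<infinity>"
      by (intro nn_integral_noteq_infinite) auto
    then show ?case by (simp add: less_top)
  qed
  then show ?thesis by (subst (asm) AE_lines) auto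
qed

text \<open>A line of mass zero meets the set where \<open>g\<close> is positive in a null
  set.\<close>

lemma AE_line_integral_pos:
  assumes [measurable]: "g \<in> borel_measurable borel"
  shows "AE x in lborel. 0 < g x \<longrightarrow> 0 < line_integral d g x"
proof -
  have "AE s in lborel. 0 < g (x + s *\<^sub>R d) \<longrightarrow> 0 < line_integral d g (x + s *\<^sub>R d)" for x
  proof (cases "line_integral d g x = 0")
    case True
    then have "AE s in lborel. g (x + s *\<^sub>R d) = 0"
      unfolding line_integral_def by (subst (asm) nn_integral_0_iff_AE) auto
    then show ?thesis by eventually_elim auto
  next
    case False
    then show ?thesis by (auto simp: line_integral_shift zero_less_iff_neq_zero)
  qed
  then show ?thesis
    by (subst AE_lines[where d = d, symmetric]) auto
qed

text \<open>The weight is the indicator of a slab orthogonal to \<open>d\<close> in which every line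
  spends parameter length one. Together with \<open>nn_integral_lines_swap\<close> it acts as a
  Fubini theorem without coordinates.\<close>

lemma transversal_weight:
  fixes d :: "'e::euclidean_space"
  assumes d: "d \<noteq> 0"
  obtains w :: "'e \<Rightarrow> ennreal" where "w \<in> borel_measurable borel" "\<And>x. w x = 0 \<or> w x = 1"
    "\<And>x. line_integral d w x = 1"
proof -
  define w :: "'e \<Rightarrow> ennreal" where "w x = indicator {0..1} ((x \<bullet> d) / (d \<bullet> d))" for x
  have w: "w \<in> borel_measurable borel"
    unfolding w_def by measurable
  have sh: "((x + s *\<^sub>R d) \<bullet> d) / (d \<bullet> d) = (x \<bullet> d) / (d \<bullet> d) + s" for x s
    using d by (simp add: inner_add_left add_divide_distrib)
  have L: "line_integral d w x = 1" for x
  proof -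
    have "line_integral d w x = (\<integral>\<^sup>+ s. indicator {0..1} ((x \<bullet> d) / (d \<bullet> d) + 1 * s) \<partial>lborel)"
      unfolding line_integral_def w_def sh by simp
    also have "\<dots> = (\<integral>\<^sup>+ s. indicator {0..1::real} s \<partial>lborel)"
      by (subst (2) nn_integral_real_affine[where c = 1 and t = "(x \<bullet> d) / (d \<bullet> d)"]) auto
    finally show ?thesis by simp
  qed
  show ?thesis
    by (rule that[OF w _ L]) (auto simp: w_def indicator_def)
qed

text \<open>The slab weight yields finiteness at almost every point of the slab. Every line spends
  positive length there and the line integral is constant on it, which extends finiteness to the
  whole space.\<close>

lemma AE_line_integral_finite:
  fixes d :: "'e::euclidean_space"
  assumes [measurable]: "f \<in> borel_measurable borel"
    and fin: "(\<integral>\<^sup>+ x. f x \<partial>lborel) < top" and d: "d \<noteq> 0"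
  shows "AE x in lborel. line_integral d f x < top"
proof -
  obtain w :: "'e \<Rightarrow> ennreal" where [measurable]: "w \<in> borel_measurable borel"
    and w: "\<And>x. w x = 0 \<or> w x = 1" and L: "\<And>x. line_integral d w x = 1"
    using transversal_weight[OF d] by metis
  have "(\<integral>\<^sup>+ x. w x * line_integral d f x \<partial>lborel) = (\<integral>\<^sup>+ x. f x \<partial>lborel)"
    by (simp add: nn_integral_lines_swap L)
  then have "AE x in lborel. w x * line_integral d f x \<noteq> \<infinity>"
    using fin by (intro nn_integral_noteq_infinite) auto
  then have "AE x in lborel. w x = 1 \<longrightarrow> line_integral d f x < top"
    by eventually_elim (auto simp: less_top)
  then have "AE x in lborel. AE s in lborel. w (x + s *\<^sub>R d) = 1 \<longrightarrow> line_integral d f (x + s *\<^sub>R d) < top"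
    by (subst AE_lines) auto
  then show ?thesis
  proof eventually_elim
    case (elim x)
    show ?case
    proof (rule ccontr)
      assume "\<not> line_integral d f x < top"
      with elim have "AE s in lborel. w (x + s *\<^sub>R d) \<noteq> 1"
        by (simp add: line_integral_shift)
      then have "AE s in lborel. w (x + s *\<^sub>R d) = 0"
        by eventually_elim (use w in blast)
      then have "line_integral d w x = 0"
        unfolding line_integral_def by (subst nn_integral_0_iff_AE) auto
      then show False using L[of x] by simp
    qed
  qed
qed

section \<open>Iterated integrals along several directions\<close>

primrec lines_integral :: "'e::euclidean_space list \<Rightarrow> ('e \<Rightarrow> ennreal) \<Rightarrow> 'e \<Rightarrow> ennreal" where
  "lines_integral [] g = g"
| "lines_integral (d # ds) g = line_integral d (lines_integral ds g)"

lemma borel_measurable_lines_integral [measurable]: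
  assumes [measurable]: "g \<in> borel_measurable borel"
  shows "lines_integral ds g \<in> borel_measurable borel"
  by (induction ds) auto

text \<open>Tonelli, one label at a time; distinctness concerns the labels \<open>ks\<close>, not
  the directions. With labels in \<open>Basis\<close> the product measure becomes
  \<open>lborel\<close> in \<open>lines_integral_matrix\<close>.\<close>

lemma lines_integral_eq_PiM:
  fixes d :: "'i \<Rightarrow> 'e::euclidean_space"
  assumes [measurable]: "g \<in> borel_measurable borel" and "distinct ks"
  shows "lines_integral (map d ks) g x
    = (\<integral>\<^sup>+ z. g (x + (\<Sum>k\<in>set ks. z k *\<^sub>R d k)) \<partial>(\<Pi>\<^sub>M k\<in>set ks. (lborel :: real measure)))"
  using assms(2)
proof (induction ks arbitrary: x)
  case Nil
  interpret product_sigma_finite "\<lambda>_::'i. lborel :: real measure" ..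
  show ?case by (simp add: PiM_empty nn_integral_count_space_finite)
next
  case (Cons k ks)
  interpret product_sigma_finite "\<lambda>_::'i. lborel :: real measure" ..
  have "(\<integral>\<^sup>+ z. g (x + (\<Sum>k\<in>set (k # ks). z k *\<^sub>R d k)) \<partial>(\<Pi>\<^sub>M k\<in>set (k # ks). (lborel :: real measure)))
    = (\<integral>\<^sup>+ s. (\<integral>\<^sup>+ z. g (x + (\<Sum>i\<in>insert k (set ks). (z(k := s)) i *\<^sub>R d i))
        \<partial>(\<Pi>\<^sub>M k\<in>set ks. (lborel :: real measure))) \<partial>lborel)"
    unfolding list.set
    by (rule product_nn_integral_insert_rev) (use Cons.prems in auto)
  also have "\<dots> = (\<integral>\<^sup>+ s. (\<integral>\<^sup>+ z. g (x + s *\<^sub>R d k + (\<Sum>i\<in>set ks. z i *\<^sub>R d i))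
        \<partial>(\<Pi>\<^sub>M k\<in>set ks. (lborel :: real measure))) \<partial>lborel)"
  proof (intro nn_integral_cong)
    fix s :: real and z :: "'i \<Rightarrow> real"
    have "(\<Sum>i\<in>set ks. (z(k := s)) i *\<^sub>R d i) = (\<Sum>i\<in>set ks. z i *\<^sub>R d i)"
      using Cons.prems by (intro sum.cong) auto
    then show "g (x + (\<Sum>i\<in>insert k (set ks). (z(k := s)) i *\<^sub>R d i))
      = g (x + s *\<^sub>R d k + (\<Sum>i\<in>set ks. z i *\<^sub>R d i))"
      using Cons.prems by (simp add: add.assoc)
  qed
  also have "\<dots> = lines_integral (map d (k # ks)) g x"
    using Cons by (simp add: line_integral_def)
  finally show ?case by simp
qed

section \<open>Transport to the truncated Gaussian\<close>

text \<open>The normalising constant of the Gaussian truncated to \<open>{-N..N}\<close>.\<close>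

definition gauss_mass :: "real \<Rightarrow> real" where
  "gauss_mass N = integral {-N..N} (\<lambda>x. exp (- x\<^sup>2 / 2))"

lemma gauss_mass_tendsto: "(\<lambda>n. gauss_mass (real n)) \<longlonglongrightarrow> sqrt (2 * pi)"
proof -
  let ?e = "\<lambda>x::real. exp (- x\<^sup>2 / 2)"
  have e: "?e = (\<lambda>x. sqrt (2 * pi) * std_normal_density x)"
    by (simp add: std_normal_density_def)
  have int: "integrable lborel ?e"
    unfolding e by (intro integrable_mult_right) auto
  have tot: "(\<integral>x. ?e x \<partial>lborel) = sqrt (2 * pi)"
    unfolding e by simp
  have eq: "gauss_mass (real n) = (\<integral>x. indicator {- real n..real n} x * ?e x \<partial>lborel)" for n
  proof -
    have "set_integrable lborel {- real n..real n} ?e"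
      unfolding set_integrable_def using int by (intro integrable_mult_indicator) auto
    then show ?thesis
      unfolding gauss_mass_def
      by (subst set_borel_integral_eq_integral(2)[symmetric]) (auto simp: set_lebesgue_integral_def)
  qed
  show ?thesis
    unfolding eq tot[symmetric]
  proof (rule integral_dominated_convergence[where w = ?e])
    show "AE x in lborel. (\<lambda>n. indicator {- real n..real n} x * ?e x) \<longlonglongrightarrow> ?e x"
    proof (rule AE_I2)
      fix x :: real
      obtain n0 :: nat where "\<bar>x\<bar> \<le> real n0" using real_arch_simple by blast
      then have "eventually (\<lambda>n. indicator {- real n..real n} x * ?e x = ?e x) sequentially"
        unfolding eventually_sequentially by (intro exI[of _ n0]) (auto simp: indicator_def)
      then show "(\<lambda>n. indicator {- real n..real n} x * ?e x) \<longlonglongrightarrow> ?e x"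
        by (rule tendsto_eventually)
    qed
  qed (use int in \<open>auto simp: indicator_def\<close>)
qed

lemma gauss_mass_pos:
  assumes "0 < N" shows "0 < gauss_mass N"
proof -
  let ?e = "\<lambda>x::real. exp (- x\<^sup>2 / 2)"
  have "integral {-N..N} (\<lambda>x. exp (- N\<^sup>2 / 2)) \<le> integral {-N..N} ?e"
  proof (intro integral_le integrable_continuous_real)
    fix x assume "x \<in> {-N..N}"
    then have "x\<^sup>2 \<le> N\<^sup>2" by (intro abs_le_square_iff[THEN iffD1]) auto
    then show "exp (- N\<^sup>2 / 2) \<le> ?e x" by simp
  qed (auto intro!: continuous_intros)
  moreover have "integral {-N..N} (\<lambda>x. exp (- N\<^sup>2 / 2)) = 2 * N * exp (- N\<^sup>2 / 2)"
    using assms by simp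
  moreover have "0 < 2 * N * exp (- N\<^sup>2 / 2)" using assms by simp
  ultimately show ?thesis unfolding gauss_mass_def by linarith
qed

text \<open>\<open>Q\<close> is the quantile function of the Gaussian truncated to \<open>{-N..N}\<close>. Freezing the density
  outside this interval makes \<open>Q\<close> a diffeomorphism of the whole line.\<close>

lemma gaussian_quantile:
  assumes N: "0 < N"
  obtains Q :: "real \<Rightarrow> real" where
    "\<And>v. (Q has_real_derivative exp (min ((Q v)\<^sup>2) (N\<^sup>2) / 2)) (at v)"
    "\<And>v. v \<in> {0..gauss_mass N} \<Longrightarrow> \<bar>Q v\<bar> \<le> N"
proof -
  define k :: "real \<Rightarrow> real" where "k x = exp (- min (x\<^sup>2) (N\<^sup>2) / 2)" for x
  have k_cont: "isCont k x" for x
    unfolding k_def by (intro continuous_intros) auto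
  have k_pos: "0 < k x" for x by (simp add: k_def)
  have k_lower: "exp (- N\<^sup>2 / 2) \<le> k x" for x by (simp add: k_def)
  obtain P where P: "\<And>x. (P has_real_derivative k x) (at x)"
    using einterval_antiderivative[of "-\<infinity>" "\<infinity>" k] k_cont
    by (auto simp: has_real_derivative_iff_has_vector_derivative)
  have P_mono: "P x < P y" if "x < y" for x y
    using DERIV_pos_imp_increasing[OF that, of P] P k_pos by blast
  have inj: "inj P"
    by (rule injI) (metis P_mono less_irrefl linorder_neqE)
  have growth: "exp (- N\<^sup>2 / 2) * (y - x) \<le> P y - P x" if "x \<le> y" for x y
  proof (cases "x = y")
    case False
    with that have "x < y" by simp
    from MVT2[OF this, of P k] P obtain z where "P y - P x = (y - x) * k z" by blast
    then show ?thesis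
      using mult_right_mono[OF k_lower[of z], of "y - x"] that by (simp add: mult.commute)
  qed simp
  have P_cont: "isCont P x" for x using P DERIV_isCont by blast
  have "\<exists>x. P x = v" for v
  proof -
    \<comment> \<open>A distance from 0 at which the linear growth of \<open>P\<close> is sure to
      have covered \<open>v - P 0\<close>.\<close>
    define r where "r = \<bar>v - P 0\<bar> / exp (- N\<^sup>2 / 2)"
    have r: "0 \<le> r" "exp (- N\<^sup>2 / 2) * r = \<bar>v - P 0\<bar>" by (auto simp: r_def)
    have "P (- r) \<le> v" "v \<le> P r"
      using growth[of 0 r] growth[of "-r" 0] r by auto
    then show ?thesis
      using IVT[of P "-r" v r] P_cont r by auto
  qed
  then have surj: "surj P" by (metis surjI)
  define R where "R = inv P"
  have PR: "P (R v) = v" for v by (simp add: R_def surj surj_f_inv_f)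
  have RP: "R (P x) = x" for x by (simp add: R_def inj)
  have R_deriv: "(R has_real_derivative exp (min ((R v)\<^sup>2) (N\<^sup>2) / 2)) (at v)" for v
  proof -
    have "isCont R (P (R v))"
      by (rule isCont_inverse_function[where d = 1]) (auto simp: RP P_cont)
    then have "(R has_real_derivative inverse (k (R v))) (at v)"
      using P[of "R v"] k_pos[of "R v"]
      by (intro DERIV_inverse_function[where f = P and a = "v - 1" and b = "v + 1"]) (auto simp: PR)
    then show ?thesis by (simp add: k_def exp_minus)
  qed
  have mass: "P N - P (- N) = gauss_mass N"
  proof -
    have "(k has_integral (P N - P (- N))) {-N..N}"
    proof (rule fundamental_theorem_of_calculus)
      show "(P has_vector_derivative k x) (at x within {-N..N})" for x
        using P[of x] by (simp add: has_real_derivative_iff_has_vector_derivative has_vector_derivative_at_within)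
    qed (use N in simp)
    moreover have "k x = exp (- x\<^sup>2 / 2)" if "x \<in> {-N..N}" for x
    proof -
      have "x\<^sup>2 \<le> N\<^sup>2" using that by (intro abs_le_square_iff[THEN iffD1]) auto
      then show ?thesis by (simp add: k_def)
    qed
    ultimately have "((\<lambda>x. exp (- x\<^sup>2 / 2)) has_integral (P N - P (- N))) {-N..N}"
      by (rule has_integral_eq[rotated])
    then show ?thesis unfolding gauss_mass_def by (simp add: integral_unique)
  qed
  show ?thesis
  proof
    \<comment> \<open>The antiderivative \<open>P\<close> is fixed only up to a constant. The shift
      by \<open>P (- N)\<close> sends \<open>0\<close> to \<open>- N\<close> and, by
      \<open>mass\<close>, \<open>gauss_mass N\<close> to \<open>N\<close>.\<close>
    show "((\<lambda>v. R (P (- N) + v)) has_real_derivative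
        exp (min ((R (P (- N) + v))\<^sup>2) (N\<^sup>2) / 2)) (at v)" for v
      using R_deriv[of "P (- N) + v"] by (simp add: DERIV_shift[symmetric] add.commute)
    show "\<bar>R (P (- N) + v)\<bar> \<le> N" if "v \<in> {0..gauss_mass N}" for v
    proof -
      have "P (- N) \<le> P (R (P (- N) + v))" "P (R (P (- N) + v)) \<le> P N"
        using that mass by (auto simp: PR)
      then show ?thesis
        using P_mono[of "R (P (- N) + v)" "- N"] P_mono[of N "R (P (- N) + v)"]
        by (cases "R (P (- N) + v) < - N"; cases "N < R (P (- N) + v)") auto
    qed
  qed
qed

lemma DERIV_distribution_function:
  fixes g :: "real \<Rightarrow> real"
  assumes cont: "continuous_on UNIV g" and nn: "\<And>s. 0 \<le> g s"
    and fin: "(\<integral>\<^sup>+ s. ennreal (g s) \<partial>lborel) < top"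
  shows "((\<lambda>s. enn2real (\<integral>\<^sup>+ \<sigma>. ennreal (g \<sigma>) * indicator {..s} \<sigma> \<partial>lborel)) has_real_derivative g s) (at s)"
proof -
  let ?F = "\<lambda>s. enn2real (\<integral>\<^sup>+ \<sigma>. ennreal (g \<sigma>) * indicator {..s} \<sigma> \<partial>lborel)"
  have [measurable]: "g \<in> borel_measurable borel"
    using cont by (rule borel_measurable_continuous_onI)
  have finF: "(\<integral>\<^sup>+ \<sigma>. ennreal (g \<sigma>) * indicator A \<sigma> \<partial>lborel) < top" for A :: "real set"
    by (rule le_less_trans[OF _ fin]) (intro nn_integral_mono, auto simp: indicator_def)
  \<comment> \<open>A base point strictly to the left of \<open>s\<close> makes \<open>s\<close>
    interior to \<open>{a..s + 1}\<close>, where the one-interval derivative is the full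
    derivative.\<close>
  define a where "a = s - 1"
  have cont': "continuous_on A g" for A using cont continuous_on_subset by blast
  have split: "?F t = ?F a + integral {a..t} g" if "a \<le> t" for t
  proof -
    have "(\<integral>\<^sup>+ \<sigma>. ennreal (g \<sigma>) * indicator {a..t} \<sigma> \<partial>lborel) = ennreal (integral {a..t} g)"
      using nn cont' by (intro nn_integral_has_integral_lebesgue' integrable_integral
          integrable_continuous_real) auto
    \<comment> \<open>The half-line and the interval share the point \<open>a\<close>, hence
      equality only almost everywhere.\<close>
    moreover have "AE \<sigma> in lborel. ennreal (g \<sigma>) * indicator {..t} \<sigma>
        = ennreal (g \<sigma>) * indicator {..a} \<sigma> + ennreal (g \<sigma>) * indicator {a..t} \<sigma>"
      using AE_lborel_singleton[of a] by eventually_elim (use that in \<open>auto simp: indicator_def\<close>)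
    then have "(\<integral>\<^sup>+ \<sigma>. ennreal (g \<sigma>) * indicator {..t} \<sigma> \<partial>lborel)
        = (\<integral>\<^sup>+ \<sigma>. ennreal (g \<sigma>) * indicator {..a} \<sigma> + ennreal (g \<sigma>) * indicator {a..t} \<sigma> \<partial>lborel)"
      by (rule nn_integral_cong_AE)
    ultimately have "(\<integral>\<^sup>+ \<sigma>. ennreal (g \<sigma>) * indicator {..t} \<sigma> \<partial>lborel)
        = (\<integral>\<^sup>+ \<sigma>. ennreal (g \<sigma>) * indicator {..a} \<sigma> \<partial>lborel) + ennreal (integral {a..t} g)"
      by (simp add: nn_integral_add)
    then show ?thesis
      using finF[of "{..a}"] nn cont' by (simp add: enn2real_plus integral_nonneg integrable_continuous_real)
  qed
  have "((\<lambda>t. integral {a..t} g) has_real_derivative g s) (at s within {a..s + 1})"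
    using cont' by (intro integral_has_real_derivative) (auto simp: a_def)
  moreover have "at s within {a..s + 1} = at s"
    by (rule at_within_interior) (auto simp: a_def)
  ultimately have "((\<lambda>t. ?F a + integral {a..t} g) has_real_derivative g s) (at s)"
    using DERIV_add[OF DERIV_const, of "\<lambda>t. integral {a..t} g" "g s" s UNIV "?F a"] by simp
  then show ?thesis
  proof (rule has_field_derivative_transform_within_open[where S = "{a<..}"])
    show "?F a + integral {a..t} g = ?F t" if "t \<in> {a<..}" for t
      using that by (intro split[symmetric]) simp
  qed (simp_all add: a_def)
qed

text \<open>Integration by parts for \<open>g T\<close> on \<open>{-R..R}\<close>. The boundary terms vanish along a sequence
  because \<open>T\<close> is bounded and \<open>g\<close> is integrable; the derivative \<open>g'\<close> need not be continuous.\<close>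

lemma transport_by_parts:
  fixes g g' T W :: "real \<Rightarrow> real"
  assumes g: "\<And>s. (g has_real_derivative g' s) (at s)" and nn: "\<And>s. 0 \<le> g s"
    and [measurable]: "g' \<in> borel_measurable borel"
    and fin: "(\<integral>\<^sup>+ s. ennreal (g s) \<partial>lborel) < top"
    and T: "\<And>s. (T has_real_derivative W s) (at s)" and T_le: "\<And>s. \<bar>T s\<bar> \<le> N"
    and W: "continuous_on UNIV W" "\<And>s. 0 \<le> W s"
  shows "(\<integral>\<^sup>+ s. ennreal (g s * W s) \<partial>lborel)
    \<le> (\<integral>\<^sup>+ s. ennreal ((g' s)\<^sup>2 / (2 * g s) + (T s)\<^sup>2 * g s / 2) \<partial>lborel)"
proof -
  define B where "B s = (g' s)\<^sup>2 / (2 * g s) + (T s)\<^sup>2 * g s / 2" for s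
  have contg: "continuous_on A g" for A
    using g by (intro continuous_at_imp_continuous_on ballI DERIV_isCont)
  have contT: "continuous_on A T" for A
    using T by (intro continuous_at_imp_continuous_on ballI DERIV_isCont)
  have contW: "continuous_on A W" for A using W(1) continuous_on_subset by blast
  have [measurable]: "g \<in> borel_measurable borel" "T \<in> borel_measurable borel" "W \<in> borel_measurable borel"
    using contg contT contW by (auto intro: borel_measurable_continuous_onI)
  have B_meas [measurable]: "B \<in> borel_measurable borel" unfolding B_def by measurable
  have B_nn: "0 \<le> B s" for s using nn[of s] by (simp add: B_def)
  have N: "0 \<le> N" using T_le[of 0] by simp
  \<comment> \<open>Young's inequality as a completed square. Where \<open>g\<close> vanishes it has
    a minimum, so \<open>g'\<close> vanishes too, in agreement with the value 0 of the quotient in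
    \<open>B\<close>.\<close>
  have pt: "- (g' s * T s) \<le> B s" for s
  proof (cases "g s = 0")
    case True
    then have "g' s = 0"
      using g[of s] nn by (intro DERIV_local_min[of g "g' s" s 1]) auto
    then show ?thesis by (simp add: B_def True)
  next
    case False
    then have "0 < g s" using nn[of s] by simp
    then have "B s + g' s * T s = (g' s + g s * T s)\<^sup>2 / (2 * g s)"
      unfolding B_def by (simp add: field_simps power2_eq_square)
    then show ?thesis using \<open>0 < g s\<close> by (smt (verit) divide_nonneg_nonneg zero_le_power2)
  qed
  show ?thesis
  proof (cases "(\<integral>\<^sup>+ s. ennreal (B s) \<partial>lborel) = top")
    case True
    then show ?thesis by (simp add: B_def)
  next
    case False
    define b where "b = integral UNIV B"
    have B_int: "B integrable_on UNIV"
      using False B_nn by (intro nn_integral_integrable_on) (auto simp: less_top)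
    have b: "(\<integral>\<^sup>+ s. ennreal (B s) \<partial>lborel) = ennreal b"
      unfolding b_def using B_nn B_int by (intro nn_integral_has_integral_lborel integrable_integral) auto
    have b_nn: "0 \<le> b" unfolding b_def using B_nn B_int by (intro integral_nonneg) auto
    have parts: "integral {-R..R} (\<lambda>s. g s * W s) \<le> N * (g R + g (-R)) + b" if "0 < R" for R
    proof -
      \<comment> \<open>The gauge integral integrates every derivative, in particular that of
        \<open>g s * T s\<close>, even if \<open>g'\<close> is discontinuous. Subtracting the
        continuous \<open>g s * W s\<close> isolates \<open>g' s * T s\<close>.\<close>
      have "((\<lambda>s. g s * T s) has_vector_derivative (g' s * T s + g s * W s)) (at s within {-R..R})" for s
        using DERIV_mult'[OF g[of s] T[of s]]
        by (simp add: has_real_derivative_iff_has_vector_derivative add.commute has_vector_derivative_at_within)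
      then have h: "((\<lambda>s. g' s * T s + g s * W s) has_integral (g R * T R - g (-R) * T (-R))) {-R..R}"
        using that by (intro fundamental_theorem_of_calculus) auto
      have gW: "(\<lambda>s. g s * W s) integrable_on {-R..R}"
        using contg contW by (intro integrable_continuous_real continuous_intros)
      have "(\<lambda>s. g s * W s - (g' s * T s + g s * W s)) integrable_on {-R..R}"
        using h gW by (intro integrable_diff) auto
      then have i: "(\<lambda>s. - (g' s * T s)) integrable_on {-R..R}" by simp
      have BR: "B integrable_on {-R..R}"
        using B_int integrable_on_subinterval by blast
      have "integral {-R..R} (\<lambda>s. g s * W s)
          = integral {-R..R} (\<lambda>s. (g' s * T s + g s * W s) + - (g' s * T s))" by simp
      also have "\<dots> = integral {-R..R} (\<lambda>s. g' s * T s + g s * W s) + integral {-R..R} (\<lambda>s. - (g' s * T s))"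
        using h i by (intro integral_add) auto
      also have "integral {-R..R} (\<lambda>s. g' s * T s + g s * W s) = g R * T R - g (-R) * T (-R)"
        using h by (rule integral_unique)
      finally have "integral {-R..R} (\<lambda>s. g s * W s)
          = g R * T R - g (-R) * T (-R) + integral {-R..R} (\<lambda>s. - (g' s * T s))" .
      moreover have "integral {-R..R} (\<lambda>s. - (g' s * T s)) \<le> integral {-R..R} B"
        using i BR pt by (intro integral_le)
      moreover have "integral {-R..R} B \<le> b"
        unfolding b_def using BR B_int B_nn by (intro integral_subset_le) auto
      moreover have "g R * T R \<le> g R * N"
        using T_le[of R] nn by (intro mult_left_mono) auto
      moreover have "g (-R) * (- T (-R)) \<le> g (-R) * N"
        using T_le[of "-R"] nn by (intro mult_left_mono) auto
      ultimately show ?thesis by (simp add: algebra_simps)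
    qed
    \<comment> \<open>Otherwise \<open>g s + g (- s)\<close> would stay above \<open>e\<close> on a
      half-line and \<open>g\<close> would have infinite integral.\<close>
    have small: "\<exists>R\<ge>r. g R + g (-R) \<le> e" if "0 < e" for r e
    proof (rule ccontr)
      assume "\<not> ?thesis"
      then have big: "e \<le> g s + g (- s)" if "r \<le> s" for s using that by force
      have "ennreal (real k) \<le> emeasure lborel {r..}" for k :: nat
        using emeasure_mono[of "{r..r + real k}" "{r..}" lborel] by auto
      then have "emeasure lborel {r..} = top"
      proof (cases "emeasure lborel {r..}")
        case (real c)
        obtain k :: nat where "c < real k" using reals_Archimedean2 by blast
        with \<open>\<And>k. ennreal (real k) \<le> emeasure lborel {r..}\<close>[of k] real show ?thesis by simp
      qed simp
      then have "top = (\<integral>\<^sup>+ s. ennreal e * indicator {r..} s \<partial>lborel)"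
        using that by (simp add: nn_integral_cmult_indicator ennreal_mult_eq_top_iff)
      also have "\<dots> \<le> (\<integral>\<^sup>+ s. ennreal (g s) + ennreal (g (- s)) \<partial>lborel)"
        using big nn by (intro nn_integral_mono)
          (auto simp: indicator_def ennreal_plus[symmetric] simp del: ennreal_plus intro!: ennreal_leI)
      also have "\<dots> = (\<integral>\<^sup>+ s. ennreal (g s) \<partial>lborel) + (\<integral>\<^sup>+ s. ennreal (g (0 + (-1) * s)) \<partial>lborel)"
        by (simp add: nn_integral_add)
      also have "(\<integral>\<^sup>+ s. ennreal (g (0 + (-1) * s)) \<partial>lborel) = (\<integral>\<^sup>+ s. ennreal (g s) \<partial>lborel)"
        using nn_integral_real_affine[of "\<lambda>s. ennreal (g s)" "-1" 0] by simp
      finally show False using fin by (simp add: top_unique)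
    qed
    have bound: "(\<integral>\<^sup>+ s. ennreal (g s * W s) * indicator {- real n..real n} s \<partial>lborel) \<le> ennreal b" for n :: nat
    proof (rule ennreal_le_epsilon)
      fix e :: real assume e: "0 < e"
      \<comment> \<open>The denominator is \<open>N + 1\<close> because \<open>N\<close> may be 0
        here.\<close>
      then have e': "0 < e / (N + 1)" using N by simp
      obtain R where R: "max 1 (real n) \<le> R" "g R + g (-R) \<le> e / (N + 1)"
        using small[OF e', of "max 1 (real n)"] by blast
      have "(\<integral>\<^sup>+ s. ennreal (g s * W s) * indicator {- real n..real n} s \<partial>lborel)
          \<le> (\<integral>\<^sup>+ s. ennreal (g s * W s) * indicator {-R..R} s \<partial>lborel)"
        using R by (intro nn_integral_mono) (auto simp: indicator_def)
      also have "\<dots> = ennreal (integral {-R..R} (\<lambda>s. g s * W s))"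
        using nn W contg contW
        by (intro nn_integral_has_integral_lebesgue' integrable_integral
            integrable_continuous_real continuous_intros) auto
      also have "\<dots> \<le> ennreal (N * (g R + g (-R)) + b)"
        using parts[of R] R by (intro ennreal_leI) auto
      also have "\<dots> \<le> ennreal (b + e)"
      proof (rule ennreal_leI)
        have "N * (g R + g (-R)) \<le> (N + 1) * (e / (N + 1))"
          using R N e' nn by (intro mult_mono) auto
        also have "\<dots> = e" using N by simp
        finally show "N * (g R + g (-R)) + b \<le> b + e" by simp
      qed
      finally show "(\<integral>\<^sup>+ s. ennreal (g s * W s) * indicator {- real n..real n} s \<partial>lborel) \<le> ennreal b + ennreal e"
        using b_nn e by simp
    qed
    have "(\<integral>\<^sup>+ s. ennreal (g s * W s) \<partial>lborel)
        = (\<integral>\<^sup>+ s. (SUP n::nat. ennreal (g s * W s) * indicator {- real n..real n} s) \<partial>lborel)"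
    proof (rule nn_integral_cong)
      fix s :: real
      obtain n0 :: nat where "\<bar>s\<bar> \<le> real n0" using real_arch_simple by blast
      then have "ennreal (g s * W s) \<le> (SUP n::nat. ennreal (g s * W s) * indicator {- real n..real n} s)"
        by (intro SUP_upper2[of n0]) (auto simp: indicator_def)
      moreover have "(SUP n::nat. ennreal (g s * W s) * indicator {- real n..real n} s) \<le> ennreal (g s * W s)"
        by (intro SUP_least) (auto simp: indicator_def)
      ultimately show "ennreal (g s * W s) = (SUP n::nat. ennreal (g s * W s) * indicator {- real n..real n} s)"
        by (rule antisym)
    qed
    also have "\<dots> = (SUP n::nat. \<integral>\<^sup>+ s. ennreal (g s * W s) * indicator {- real n..real n} s \<partial>lborel)"
      by (intro nn_integral_monotone_convergence_SUP)
        (auto simp: incseq_def le_fun_def indicator_def)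
    also have "\<dots> \<le> ennreal b" using bound by (intro SUP_least)
    finally show ?thesis unfolding b[symmetric] B_def .
  qed
qed

section \<open>Logarithmic Sobolev inequality along lines\<close>

locale line_density =
  fixes f f' :: "'e::euclidean_space \<Rightarrow> real" and d :: 'e
  assumes nn: "0 \<le> f x"
    and meas [measurable]: "f \<in> borel_measurable borel" "f' \<in> borel_measurable borel"
    and deriv: "((\<lambda>s. f (x + s *\<^sub>R d)) has_real_derivative f' x) (at 0)"
    and total: "(\<integral>\<^sup>+ x. ennreal (f x) \<partial>lborel) = 1"
begin

abbreviation "m \<equiv> line_integral d (\<lambda>x. ennreal (f x))"

definition "good x \<longleftrightarrow> 0 < m x \<and> m x < top"

lemma good_measurable [measurable]: "Measurable.pred borel good"
  unfolding good_def by measurable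

lemma good_shift: "good (x + s *\<^sub>R d) = good x"
  by (simp add: good_def line_integral_shift)

lemma deriv_line: "((\<lambda>s. f (x + s *\<^sub>R d)) has_real_derivative f' (x + s *\<^sub>R d)) (at s)"
  using DERIV_shift[of "\<lambda>s. f (x + s *\<^sub>R d)" _ 0 s] deriv[of "x + s *\<^sub>R d"]
  by (simp add: algebra_simps)

text \<open>The unnormalised distribution function of the line, read as a function of its points. In
  this form it is measurable on the whole space, and so is the transport map built from it.\<close>

definition cdf :: "'e \<Rightarrow> real" where
  "cdf x = enn2real (\<integral>\<^sup>+ \<sigma>. ennreal (f (x + \<sigma> *\<^sub>R d)) * indicator {..0} \<sigma> \<partial>lborel)"

lemma cdf_measurable [measurable]: "cdf \<in> borel_measurable borel"
  unfolding cdf_def by measurable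

lemma cdf_shift:
  "cdf (x + s *\<^sub>R d) = enn2real (\<integral>\<^sup>+ \<sigma>. ennreal (f (x + \<sigma> *\<^sub>R d)) * indicator {..s} \<sigma> \<partial>lborel)"
proof -
  have "(\<integral>\<^sup>+ \<sigma>. ennreal (f (x + \<sigma> *\<^sub>R d)) * indicator {..s} \<sigma> \<partial>lborel)
      = (\<integral>\<^sup>+ \<sigma>. ennreal (f (x + (s + 1 * \<sigma>) *\<^sub>R d)) * indicator {..s} (s + 1 * \<sigma>) \<partial>lborel)"
    by (subst nn_integral_real_affine[where c = 1 and t = s]) auto
  also have "\<dots> = (\<integral>\<^sup>+ \<sigma>. ennreal (f (x + s *\<^sub>R d + \<sigma> *\<^sub>R d)) * indicator {..0} \<sigma> \<partial>lborel)"
    by (intro nn_integral_cong) (auto simp: algebra_simps indicator_def)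
  finally show ?thesis by (simp add: cdf_def)
qed

lemma cdf_bounds: "0 \<le> cdf x" "m x < top \<Longrightarrow> cdf x \<le> enn2real (m x)"
  unfolding cdf_def line_integral_def
  by (auto intro!: enn2real_mono nn_integral_mono simp: indicator_def)

lemma deriv_cdf:
  assumes "m x < top"
  shows "((\<lambda>s. cdf (x + s *\<^sub>R d)) has_real_derivative f (x + s *\<^sub>R d)) (at s)"
  unfolding cdf_shift
proof (rule DERIV_distribution_function)
  show "continuous_on UNIV (\<lambda>s. f (x + s *\<^sub>R d))"
    using deriv_line by (intro continuous_at_imp_continuous_on ballI DERIV_isCont)
  show "(\<integral>\<^sup>+ s. ennreal (f (x + s *\<^sub>R d)) \<partial>lborel) < top"
    using assms by (simp add: line_integral_def)
qed (rule nn)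

text \<open>The pointwise inequality is \<open>ln T' \<le> T' - 1\<close> for the monotone map \<open>T\<close> which, on every line in
  direction \<open>d\<close>, transports \<open>f / m\<close> to the truncated Gaussian; \<open>D = T' - T\<^sup>2 / 2\<close>.\<close>

lemma log_sobolev_pointwise:
  assumes N: "0 < N" and I: "integrable lborel (\<lambda>x. (f' x)\<^sup>2 / f x)"
  obtains D where
    "\<And>x. 0 < f x \<Longrightarrow> good x \<Longrightarrow> ln (f x / enn2real (m x)) \<le> D x - 1 - ln (gauss_mass N)"
    "integrable lborel (\<lambda>x. f x * D x)"
    "(\<integral>x. f x * D x \<partial>lborel) \<le> (\<integral>x. (f' x)\<^sup>2 / f x \<partial>lborel) / 2"
proof -
  obtain Q where Q: "\<And>v. (Q has_real_derivative exp (min ((Q v)\<^sup>2) (N\<^sup>2) / 2)) (at v)"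
    and Q_le: "\<And>v. v \<in> {0..gauss_mass N} \<Longrightarrow> \<bar>Q v\<bar> \<le> N"
    using gaussian_quantile[OF N] by blast
  have "continuous_on UNIV Q"
    using Q by (intro continuous_at_imp_continuous_on ballI DERIV_isCont)
  then have [measurable]: "Q \<in> borel_measurable borel" by (rule borel_measurable_continuous_onI)
  define c where "c = gauss_mass N"
  have c: "0 < c" unfolding c_def by (rule gauss_mass_pos[OF N])
  define mr where "mr x = enn2real (m x)" for x
  have [measurable]: "mr \<in> borel_measurable borel" unfolding mr_def by measurable
  have mr: "0 < mr x" "m x = ennreal (mr x)" if "good x" for x
    using that by (auto simp: mr_def good_def enn2real_positive_iff)
  have mr_shift: "mr (x + s *\<^sub>R d) = mr x" for x s
    by (simp add: mr_def line_integral_shift)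
  \<comment> \<open>Divided by \<open>mr x\<close> and rescaled by \<open>c\<close>, the
    distribution function lands in \<open>{0..c}\<close>, where \<open>Q\<close> is bounded by
    \<open>N\<close>. The value 0 off \<open>good\<close> lines keeps \<open>T\<close> bounded and
    measurable.\<close>
  define T where "T x = (if good x then Q (c * (cdf x / mr x)) else 0)" for x
  define W where "W x = (if good x then c / mr x * f x * exp ((T x)\<^sup>2 / 2) else 0)" for x
  have [measurable]: "T \<in> borel_measurable borel" unfolding T_def by measurable
  have [measurable]: "W \<in> borel_measurable borel" unfolding W_def by measurable
  have T_le: "\<bar>T x\<bar> \<le> N" for x
  proof (cases "good x")
    case True
    have "cdf x / mr x \<in> {0..1}"
      using cdf_bounds[of x] mr(1)[OF True] True by (simp add: mr_def good_def)
    then have "0 \<le> cdf x / mr x" "cdf x / mr x \<le> 1" by simp_all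
    then have "0 \<le> c * (cdf x / mr x)" "c * (cdf x / mr x) \<le> c"
      using c by (intro mult_nonneg_nonneg mult_left_le; simp)+
    then have "\<bar>Q (c * (cdf x / mr x))\<bar> \<le> N" by (intro Q_le) (simp add: c_def)
    then show ?thesis using True by (simp add: T_def)
  qed (use N in \<open>simp add: T_def\<close>)
  \<comment> \<open>This removes the minimum from the derivative of \<open>Q\<close>, so that
    \<open>W\<close> is the derivative of \<open>T\<close> along the line.\<close>
  have T_sq: "(T x)\<^sup>2 \<le> N\<^sup>2" for x
    using T_le[of x] N by (intro abs_le_square_iff[THEN iffD1]) auto
  have W_nn: "0 \<le> W x" for x
    using c nn[of x] mr[of x] by (auto simp: W_def)
  have T_line: "((\<lambda>s. T (x + s *\<^sub>R d)) has_real_derivative W (x + s *\<^sub>R d)) (at s)" if "good x" for x s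
  proof -
    have Teq: "T (x + s *\<^sub>R d) = Q (c * (cdf (x + s *\<^sub>R d) / mr x))" for s
      using that by (simp add: T_def good_shift mr_shift)
    have "((\<lambda>s. c * (cdf (x + s *\<^sub>R d) / mr x)) has_real_derivative c * (f (x + s *\<^sub>R d) / mr x)) (at s)"
      using that by (intro DERIV_cmult DERIV_cdivide deriv_cdf) (simp add: good_def)
    from DERIV_chain'[OF this Q]
    have "((\<lambda>s. T (x + s *\<^sub>R d)) has_real_derivative
        exp (min ((T (x + s *\<^sub>R d))\<^sup>2) (N\<^sup>2) / 2) * (c * (f (x + s *\<^sub>R d) / mr x))) (at s)"
      unfolding Teq by (simp add: mult.commute)
    then show ?thesis
      using that T_sq[of "x + s *\<^sub>R d"] by (simp add: W_def good_shift mr_shift min_absorb1 mult_ac)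
  qed
  define B where "B x = (f' x)\<^sup>2 / (2 * f x) + (T x)\<^sup>2 * f x / 2" for x
  have [measurable]: "B \<in> borel_measurable borel" unfolding B_def by measurable
  have B_nn: "0 \<le> B x" for x using nn[of x] by (simp add: B_def)
  have line: "line_integral d (\<lambda>x. ennreal (f x * W x)) x \<le> line_integral d (\<lambda>x. ennreal (if good x then B x else 0)) x" for x
  proof (cases "good x")
    case True
    have cont: "continuous_on UNIV (\<lambda>s. W (x + s *\<^sub>R d))"
    proof -
      have "continuous_on UNIV (\<lambda>s. f (x + s *\<^sub>R d))" "continuous_on UNIV (\<lambda>s. T (x + s *\<^sub>R d))"
        using deriv_line T_line[OF True] by (auto intro!: continuous_at_imp_continuous_on DERIV_isCont)
      then have "continuous_on UNIV (\<lambda>s. c / mr x * f (x + s *\<^sub>R d) * exp ((T (x + s *\<^sub>R d))\<^sup>2 / 2))"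
        by (intro continuous_intros) auto
      then show ?thesis using True by (simp add: W_def good_shift mr_shift)
    qed
    have "(\<integral>\<^sup>+ s. ennreal (f (x + s *\<^sub>R d) * W (x + s *\<^sub>R d)) \<partial>lborel)
        \<le> (\<integral>\<^sup>+ s. ennreal ((f' (x + s *\<^sub>R d))\<^sup>2 / (2 * f (x + s *\<^sub>R d))
            + (T (x + s *\<^sub>R d))\<^sup>2 * f (x + s *\<^sub>R d) / 2) \<partial>lborel)"
    proof (rule transport_by_parts)
      show "(\<integral>\<^sup>+ s. ennreal (f (x + s *\<^sub>R d)) \<partial>lborel) < top"
        using True by (simp add: good_def line_integral_def)
    qed (auto intro: deriv_line nn T_line[OF True] T_le cont W_nn)
    then show ?thesis using True by (simp add: line_integral_def good_shift B_def)
  next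
    case False
    then show ?thesis by (simp add: line_integral_def W_def good_shift)
  qed
  \<comment> \<open>The inequality on lines is integrated against the weights \<open>f / m\<close>.
    Both integrands are 0 off \<open>good\<close> lines, which is the support condition of
    \<open>nn_integral_disintegrate\<close>.\<close>
  have "(\<integral>\<^sup>+ x. ennreal (f x * W x) \<partial>lborel)
      = (\<integral>\<^sup>+ x. (ennreal (f x) / m x) * line_integral d (\<lambda>x. ennreal (f x * W x)) x \<partial>lborel)"
    by (rule nn_integral_disintegrate) (auto simp: W_def good_def split: if_splits)
  also have "\<dots> \<le> (\<integral>\<^sup>+ x. (ennreal (f x) / m x) * line_integral d (\<lambda>x. ennreal (if good x then B x else 0)) x \<partial>lborel)"
    by (intro nn_integral_mono mult_left_mono line) auto
  also have "\<dots> = (\<integral>\<^sup>+ x. ennreal (if good x then B x else 0) \<partial>lborel)"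
    by (rule nn_integral_disintegrate[symmetric]) (auto simp: good_def split: if_splits)
  also have "\<dots> \<le> (\<integral>\<^sup>+ x. ennreal (B x) \<partial>lborel)"
    using B_nn by (intro nn_integral_mono) auto
  finally have le: "(\<integral>\<^sup>+ x. ennreal (f x * W x) \<partial>lborel) \<le> (\<integral>\<^sup>+ x. ennreal (B x) \<partial>lborel)" .
  have f_int: "integrable lborel f"
    using total nn by (intro integrableI_nonneg) auto
  \<comment> \<open>Integrability rests on the bound of \<open>T\<close> by \<open>N\<close>, one of
    the purposes of the truncation.\<close>
  have Tf_int: "integrable lborel (\<lambda>x. (T x)\<^sup>2 * f x / 2)"
  proof (rule Bochner_Integration.integrable_bound[OF integrable_mult_right[OF f_int, of "N\<^sup>2"]])
    have "norm ((T x)\<^sup>2 * f x / 2) \<le> norm (N\<^sup>2 * f x)" for x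
    proof -
      have "0 \<le> (T x)\<^sup>2 * f x" "(T x)\<^sup>2 * f x \<le> N\<^sup>2 * f x"
        using nn[of x] by (auto intro: mult_right_mono T_sq)
      then show ?thesis by simp
    qed
    then show "AE x in lborel. norm ((T x)\<^sup>2 * f x / 2) \<le> norm (N\<^sup>2 * f x)" by simp
  qed measurable
  have I2: "integrable lborel (\<lambda>x. (f' x)\<^sup>2 / (2 * f x))"
    using integrable_divide[OF I, of 2] by (simp add: mult.commute)
  have B_int: "integrable lborel B"
    unfolding B_def by (intro Bochner_Integration.integrable_add I2 Tf_int)
  have B_val: "(\<integral>x. B x \<partial>lborel) = (\<integral>x. (f' x)\<^sup>2 / f x \<partial>lborel) / 2 + (\<integral>x. (T x)\<^sup>2 * f x / 2 \<partial>lborel)"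
    unfolding B_def using I2 Tf_int
    by (subst Bochner_Integration.integral_add) (auto simp flip: integral_divide_zero simp: mult.commute)
  have fW_int: "integrable lborel (\<lambda>x. f x * W x)"
  proof (rule integrableI_nonneg)
    show "(\<integral>\<^sup>+ x. ennreal (f x * W x) \<partial>lborel) < \<infinity>"
      using le B_int B_nn by (auto simp: nn_integral_eq_integral less_top[symmetric] top_unique)
  qed (use nn W_nn in auto)
  have fW_le: "(\<integral>x. f x * W x \<partial>lborel) \<le> (\<integral>x. B x \<partial>lborel)"
    using le fW_int B_int B_nn nn W_nn by (simp add: nn_integral_eq_integral)
  show ?thesis
  proof (rule that[of "\<lambda>x. W x - (T x)\<^sup>2 / 2"])
    fix x assume x: "0 < f x" "good x"
    have W_pos: "0 < W x" using x c mr(1)[OF x(2)] by (simp add: W_def)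
    \<comment> \<open>The change of variables: \<open>W x\<close> is the derivative of the transport
      map, and the remaining factor is the truncated Gaussian density at \<open>T x\<close>.\<close>
    have "f x / mr x = W x * exp (- ((T x)\<^sup>2 / 2)) / c"
      using x c mr(1)[OF x(2)] by (simp add: W_def exp_minus field_simps)
    then have "ln (f x / mr x) = ln (W x) - (T x)\<^sup>2 / 2 - ln c"
      using W_pos c by (simp add: ln_mult ln_div)
    also have "\<dots> \<le> (W x - (T x)\<^sup>2 / 2) - 1 - ln c"
      using ln_le_minus_one[OF W_pos] by simp
    finally show "ln (f x / enn2real (m x)) \<le> (W x - (T x)\<^sup>2 / 2) - 1 - ln (gauss_mass N)"
      by (simp add: mr_def c_def)
  next
    have eq: "f x * (W x - (T x)\<^sup>2 / 2) = f x * W x - (T x)\<^sup>2 * f x / 2" for x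
      by (simp add: algebra_simps)
    show "integrable lborel (\<lambda>x. f x * (W x - (T x)\<^sup>2 / 2))"
      unfolding eq by (intro Bochner_Integration.integrable_diff fW_int Tf_int)
    \<comment> \<open>The integral of \<open>(T x)\<^sup>2 * f x / 2\<close> in \<open>B_val\<close>
      cancels against the one subtracted here; half the Fisher information remains.\<close>
    show "(\<integral>x. f x * (W x - (T x)\<^sup>2 / 2) \<partial>lborel) \<le> (\<integral>x. (f' x)\<^sup>2 / f x \<partial>lborel) / 2"
      unfolding eq using fW_le B_val by (simp add: Bochner_Integration.integral_diff fW_int Tf_int)
  qed
qed

end

text \<open>The factor \<open>r\<close> in the inductive step compares the conditional density of one coordinate given the
  remaining ones with the one given only the coordinates not yet integrated out; \<open>ln r \<le> r - 1\<close>
  has nonpositive expectation, so entropies of marginals never appear.\<close>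

lemma log_ratio_lines_le:
  fixes f :: "'e::euclidean_space \<Rightarrow> real" and f' :: "'e \<Rightarrow> 'e \<Rightarrow> real"
  assumes dens: "\<And>d. d \<in> set ds \<Longrightarrow> line_density f (f' d) d"
    and nz: "\<And>d. d \<in> set ds \<Longrightarrow> d \<noteq> 0"
    and I: "\<And>d. d \<in> set ds \<Longrightarrow> integrable lborel (\<lambda>x. (f' d x)\<^sup>2 / f x)"
    and N: "0 < N" and f_nn: "\<And>x. 0 \<le> f x"
    and meas [measurable]: "f \<in> borel_measurable borel"
    and total: "(\<integral>\<^sup>+ x. ennreal (f x) \<partial>lborel) = 1"
    and fin: "AE x in lborel. lines_integral ds (\<lambda>x. ennreal (f x)) x < top"
  shows "\<exists>E. integrable lborel (\<lambda>x. f x * E x)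
    \<and> (\<integral>x. f x * E x \<partial>lborel) \<le> (\<Sum>d\<leftarrow>ds. (\<integral>x. (f' d x)\<^sup>2 / f x \<partial>lborel) / 2 - 1 - ln (gauss_mass N))
    \<and> (AE x in lborel. 0 < f x \<longrightarrow> 0 < lines_integral ds (\<lambda>x. ennreal (f x)) x
        \<and> ln (f x / enn2real (lines_integral ds (\<lambda>x. ennreal (f x)) x)) \<le> E x)"
  using dens nz I fin
proof (induction ds)
  case Nil
  show ?case by (intro exI[of _ "\<lambda>_. 0"]) auto
next
  case (Cons d ds)
  let ?f = "\<lambda>x. ennreal (f x)"
  let ?g = "lines_integral ds ?f"
  let ?h = "line_integral d ?g"
  interpret line_density f "f' d" d using Cons.prems(1) by simp
  have hfin: "AE x in lborel. ?h x < top" using Cons.prems(4) by simp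
  then have gfin: "AE x in lborel. ?g x < top"
    by (rule AE_line_integral_finite_imp[rotated]) measurable
  obtain E where E: "integrable lborel (\<lambda>x. f x * E x)"
    "(\<integral>x. f x * E x \<partial>lborel) \<le> (\<Sum>d\<leftarrow>ds. (\<integral>x. (f' d x)\<^sup>2 / f x \<partial>lborel) / 2 - 1 - ln (gauss_mass N))"
    "AE x in lborel. 0 < f x \<longrightarrow> 0 < ?g x \<and> ln (f x / enn2real (?g x)) \<le> E x"
    using Cons.IH[OF _ _ _ gfin] Cons.prems by (auto simp del: sum_list.Cons)
  obtain D where D: "\<And>x. 0 < f x \<Longrightarrow> good x \<Longrightarrow> ln (f x / enn2real (m x)) \<le> D x - 1 - ln (gauss_mass N)"
    "integrable lborel (\<lambda>x. f x * D x)"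
    "(\<integral>x. f x * D x \<partial>lborel) \<le> (\<integral>x. (f' d x)\<^sup>2 / f x \<partial>lborel) / 2"
    using log_sobolev_pointwise[OF N Cons.prems(3)] by auto
  have mfin: "AE x in lborel. m x < top"
    using Cons.prems(2)[of d] total by (intro AE_line_integral_finite) auto
  \<comment> \<open>\<open>?g / ?h\<close> conditions on the coordinates outside
    \<open>d # ds\<close>, and \<open>f / m\<close> on all coordinates other than that of
    \<open>d\<close>; \<open>r\<close> is the first divided by the second.\<close>
  define r where "r x = enn2real (?g x) * enn2real (m x) / (enn2real (?h x) * f x)" for x
  have [measurable]: "r \<in> borel_measurable borel" unfolding r_def by measurable
  have r_nn: "0 \<le> r x" for x using f_nn[of x] by (simp add: r_def)
  have fr_le: "(\<integral>\<^sup>+ x. ennreal (f x * r x) \<partial>lborel) \<le> 1"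
  proof -
    have "(\<integral>\<^sup>+ x. ennreal (f x * r x) \<partial>lborel) \<le> (\<integral>\<^sup>+ x. (?g x / ?h x) * m x \<partial>lborel)"
    proof (rule nn_integral_mono_AE)
      have pos: "AE x in lborel. 0 < ?g x \<longrightarrow> 0 < ?h x"
        by (rule AE_line_integral_pos) measurable
      show "AE x in lborel. ennreal (f x * r x) \<le> (?g x / ?h x) * m x"
        using pos hfin gfin mfin
      proof eventually_elim
        case (elim x)
        show ?case
        proof (cases "f x = 0 \<or> ?g x = 0")
          case True then show ?thesis by (auto simp: r_def)
        next
          case False
          obtain a where a: "?g x = ennreal a" "0 \<le> a" using elim(3) by (cases "?g x") auto
          obtain b where b: "?h x = ennreal b" "0 \<le> b" using elim(2) by (cases "?h x") auto
          obtain e where e: "m x = ennreal e" "0 \<le> e" using elim(4) by (cases "m x") auto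
          have "0 < b" using False elim(1) b by (auto simp: zero_less_iff_neq_zero)
          then show ?thesis
            using False a(2) b(2) e(2) unfolding r_def a(1) b(1) e(1)
            by (simp add: divide_ennreal ennreal_mult[symmetric])
        qed
      qed
    qed
    also have "\<dots> \<le> (\<integral>\<^sup>+ x. ?f x \<partial>lborel)"
      by (rule nn_integral_ratio_le) measurable
    finally show ?thesis by (simp add: total)
  qed
  have fr_int: "integrable lborel (\<lambda>x. f x * r x)"
    using fr_le f_nn r_nn by (intro integrableI_nonneg) (auto simp: less_top[symmetric] top_unique)
  have fr_val: "(\<integral>x. f x * r x \<partial>lborel) \<le> 1"
    using fr_le fr_int f_nn r_nn by (simp add: nn_integral_eq_integral)
  have f_int: "integrable lborel f" and f_val: "(\<integral>x. f x \<partial>lborel) = 1"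
    using total f_nn nn_integral_eq_integral[of lborel f] integral_eq_nn_integral[of f lborel]
    by (auto intro!: integrableI_nonneg)
  \<comment> \<open>The constant 2 collects the two uses of \<open>ln t \<le> t - 1\<close>, for the
    transport map and for \<open>r\<close>. The second unit is compensated by the expectation of
    \<open>r\<close>, which is at most 1.\<close>
  define E' where "E' x = E x + D x + r x - (2 + ln (gauss_mass N))" for x
  have eq: "f x * E' x = f x * E x + f x * D x + f x * r x - (2 + ln (gauss_mass N)) * f x" for x
    by (simp add: E'_def algebra_simps)
  show ?case
  proof (intro exI[of _ E'] conjI)
    show "integrable lborel (\<lambda>x. f x * E' x)"
      unfolding eq using E(1) D(2) fr_int f_int by auto
    have "(\<integral>x. f x * E' x \<partial>lborel) = (\<integral>x. f x * E x \<partial>lborel) + (\<integral>x. f x * D x \<partial>lborel)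
        + (\<integral>x. f x * r x \<partial>lborel) - (2 + ln (gauss_mass N))"
      unfolding eq using E(1) D(2) fr_int f_int f_val by (simp add: Bochner_Integration.integral_add)
    then show "(\<integral>x. f x * E' x \<partial>lborel)
        \<le> (\<Sum>d\<leftarrow>d # ds. (\<integral>x. (f' d x)\<^sup>2 / f x \<partial>lborel) / 2 - 1 - ln (gauss_mass N))"
      using E(2) D(3) fr_val by simp
    have gpos: "AE x in lborel. 0 < ?g x \<longrightarrow> 0 < ?h x"
      by (rule AE_line_integral_pos) measurable
    have mpos: "AE x in lborel. 0 < ?f x \<longrightarrow> 0 < m x"
      by (rule AE_line_integral_pos) measurable
    show "AE x in lborel. 0 < f x \<longrightarrow> 0 < lines_integral (d # ds) ?f x
        \<and> ln (f x / enn2real (lines_integral (d # ds) ?f x)) \<le> E' x"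
      using E(3) gpos mpos hfin gfin mfin
    proof eventually_elim
      case (elim x)
      show ?case
      proof (intro impI conjI)
        assume fx: "0 < f x"
        then have pos: "0 < ?g x" "0 < ?h x" "0 < m x" using elim by auto
        then show "0 < lines_integral (d # ds) ?f x" by simp
        have reals: "0 < enn2real (?g x)" "0 < enn2real (?h x)" "0 < enn2real (m x)"
          using pos elim by (auto simp: enn2real_positive_iff)
        have "0 < r x" unfolding r_def using reals fx by simp
        \<comment> \<open>The chain rule f/h = (f/g) (g/h), with g/h written as (f/m) r.\<close>
        have "f x / enn2real (?h x) = (f x / enn2real (?g x)) * ((f x / enn2real (m x)) * r x)"
          unfolding r_def using reals fx by (simp add: field_simps)
        then have "ln (f x / enn2real (?h x)) = ln (f x / enn2real (?g x)) + (ln (f x / enn2real (m x)) + ln (r x))"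
          using reals fx \<open>0 < r x\<close> by (simp add: ln_mult ln_div)
        also have "\<dots> \<le> E x + ((D x - 1 - ln (gauss_mass N)) + (r x - 1))"
          using elim fx D(1)[of x] pos ln_le_minus_one[OF \<open>0 < r x\<close>]
          by (intro add_mono) (auto simp: good_def)
        finally show "ln (f x / enn2real (lines_integral (d # ds) ?f x)) \<le> E' x"
          by (simp add: E'_def)
      qed
    qed
  qed
qed

text \<open>The left side does not involve \<open>N\<close>, so the truncation is removed by a limit
  in the bounds alone, taken along \<open>real (Suc n)\<close> to keep \<open>N\<close>
  positive.\<close>

proposition log_sobolev_lines:
  fixes f :: "'e::euclidean_space \<Rightarrow> real" and f' :: "'e \<Rightarrow> 'e \<Rightarrow> real"
  assumes dens: "\<And>d. d \<in> set ds \<Longrightarrow> line_density f (f' d) d"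
    and nz: "\<And>d. d \<in> set ds \<Longrightarrow> d \<noteq> 0"
    and I: "\<And>d. d \<in> set ds \<Longrightarrow> integrable lborel (\<lambda>x. (f' d x)\<^sup>2 / f x)"
    and f_nn: "\<And>x. 0 \<le> f x"
    and meas [measurable]: "f \<in> borel_measurable borel"
    and total: "(\<integral>\<^sup>+ x. ennreal (f x) \<partial>lborel) = 1"
    and fin: "AE x in lborel. lines_integral ds (\<lambda>x. ennreal (f x)) x < top"
    and ent: "integrable lborel (\<lambda>x. f x * ln (f x / enn2real (lines_integral ds (\<lambda>x. ennreal (f x)) x)))"
  shows "(\<integral>x. f x * ln (f x / enn2real (lines_integral ds (\<lambda>x. ennreal (f x)) x)) \<partial>lborel)
    \<le> (\<Sum>d\<leftarrow>ds. (\<integral>x. (f' d x)\<^sup>2 / f x \<partial>lborel) / 2 - 1 - ln (2 * pi) / 2)"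
proof -
  let ?L = "\<integral>x. f x * ln (f x / enn2real (lines_integral ds (\<lambda>x. ennreal (f x)) x)) \<partial>lborel"
  have bound: "?L \<le> (\<Sum>d\<leftarrow>ds. (\<integral>x. (f' d x)\<^sup>2 / f x \<partial>lborel) / 2 - 1 - ln (gauss_mass N))"
    if N: "0 < N" for N
  proof -
    obtain E where E: "integrable lborel (\<lambda>x. f x * E x)"
      "(\<integral>x. f x * E x \<partial>lborel) \<le> (\<Sum>d\<leftarrow>ds. (\<integral>x. (f' d x)\<^sup>2 / f x \<partial>lborel) / 2 - 1 - ln (gauss_mass N))"
      "AE x in lborel. 0 < f x \<longrightarrow> 0 < lines_integral ds (\<lambda>x. ennreal (f x)) x
        \<and> ln (f x / enn2real (lines_integral ds (\<lambda>x. ennreal (f x)) x)) \<le> E x"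
      using log_ratio_lines_le[of ds f f' N] dens nz I N f_nn meas total fin by blast
    have "?L \<le> (\<integral>x. f x * E x \<partial>lborel)"
    proof (rule integral_mono_AE[OF ent E(1)])
      show "AE x in lborel. f x * ln (f x / enn2real (lines_integral ds (\<lambda>x. ennreal (f x)) x)) \<le> f x * E x"
        using E(3)
      proof eventually_elim
        case (elim x)
        then show ?case using f_nn[of x] by (cases "f x = 0") (auto intro: mult_left_mono)
      qed
    qed
    with E(2) show ?thesis by simp
  qed
  have "(\<lambda>n. ln (gauss_mass (real (Suc n)))) \<longlonglongrightarrow> ln (sqrt (2 * pi))"
    using LIMSEQ_Suc[OF gauss_mass_tendsto] by (intro tendsto_ln) auto
  then have "(\<lambda>n. \<Sum>d\<leftarrow>ds. (\<integral>x. (f' d x)\<^sup>2 / f x \<partial>lborel) / 2 - 1 - ln (gauss_mass (real (Suc n))))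
      \<longlonglongrightarrow> (\<Sum>d\<leftarrow>ds. (\<integral>x. (f' d x)\<^sup>2 / f x \<partial>lborel) / 2 - 1 - ln (sqrt (2 * pi)))"
    by (induction ds) (auto intro!: tendsto_intros)
  then have "?L \<le> (\<Sum>d\<leftarrow>ds. (\<integral>x. (f' d x)\<^sup>2 / f x \<partial>lborel) / 2 - 1 - ln (sqrt (2 * pi)))"
    by (rule LIMSEQ_le_const) (intro exI[of _ 0] allI impI bound, simp)
  then show ?thesis by (simp add: ln_sqrt)
qed

section \<open>Conditional entropy and Fisher information\<close>

text \<open>The change-of-variables theorem for linear maps in the library needs a well-ordered index type.
  Products of elementary matrices suffice here: they diagonalise positive definite forms by congruence.\<close>

definition volume_scaling :: "real^'n^'n \<Rightarrow> bool" where
  "volume_scaling B \<longleftrightarrow> det B \<noteq> 0 \<and>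
     (\<forall>g :: real^'n \<Rightarrow> ennreal. g \<in> borel_measurable borel \<longrightarrow>
       (\<integral>\<^sup>+ v. g (B *v v) \<partial>lborel) = ennreal (1 / \<bar>det B\<bar>) * (\<integral>\<^sup>+ v. g v \<partial>lborel))"

lemma measurable_matrix_vector_mult [measurable]:
  fixes B :: "real^'n^'m"
  shows "(\<lambda>v. B *v v) \<in> borel_measurable borel"
  by (intro borel_measurable_continuous_onI linear_continuous_on linear_conv_bounded_linear[THEN iffD1]
      matrix_vector_mul_linear)

lemma volume_scaling_id: "volume_scaling (mat 1)"
  by (simp add: volume_scaling_def)

lemma volume_scaling_mult:
  assumes A: "volume_scaling A" and B: "volume_scaling B"
  shows "volume_scaling (A ** B)"
  unfolding volume_scaling_def
proof (intro conjI allI impI)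
  show "det (A ** B) \<noteq> 0" using A B by (simp add: volume_scaling_def det_mul)
  fix g :: "real^'a \<Rightarrow> ennreal" assume [measurable]: "g \<in> borel_measurable borel"
  have "(\<integral>\<^sup>+ v. g (A *v (B *v v)) \<partial>lborel) = ennreal (1 / \<bar>det B\<bar>) * (\<integral>\<^sup>+ v. g (A *v v) \<partial>lborel)"
    using B unfolding volume_scaling_def
    by (elim conjE allE[of _ "\<lambda>v. g (A *v v)"]) simp
  also have "(\<integral>\<^sup>+ v. g (A *v v) \<partial>lborel) = ennreal (1 / \<bar>det A\<bar>) * (\<integral>\<^sup>+ v. g v \<partial>lborel)"
    using A by (simp add: volume_scaling_def)
  finally have "(\<integral>\<^sup>+ v. g (A *v (B *v v)) \<partial>lborel)
      = (ennreal (1 / \<bar>det B\<bar>) * ennreal (1 / \<bar>det A\<bar>)) * (\<integral>\<^sup>+ v. g v \<partial>lborel)"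
    by (simp only: mult.assoc)
  also have "ennreal (1 / \<bar>det B\<bar>) * ennreal (1 / \<bar>det A\<bar>) = ennreal (1 / \<bar>det (A ** B)\<bar>)"
    by (subst ennreal_mult[symmetric]) (simp_all add: det_mul abs_mult)
  finally show "(\<integral>\<^sup>+ v. g (A ** B *v v) \<partial>lborel) = ennreal (1 / \<bar>det (A ** B)\<bar>) * (\<integral>\<^sup>+ v. g v \<partial>lborel)"
    by (simp only: matrix_vector_mul_assoc)
qed

section \<open>Elementary matrices and congruence to the identity\<close>

definition elementary :: "'n \<Rightarrow> real^'n \<Rightarrow> real^'n^'n" where
  "elementary k w = (\<chi> i. if i = k then axis k 1 + w else axis i 1)"

lemma elementary_mult: "elementary k w *v v = v + (w \<bullet> v) *\<^sub>R axis k 1"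
proof (rule vec_eq_iff[THEN iffD2], rule allI)
  fix i
  have "(elementary k w *v v) $ i = (elementary k w $ i) \<bullet> v"
    by (simp add: matrix_vector_mul_component)
  also have "\<dots> = (v + (w \<bullet> v) *\<^sub>R axis k 1) $ i"
    by (simp add: elementary_def inner_add_left inner_axis') (simp add: axis_def)
  finally show "(elementary k w *v v) $ i = (v + (w \<bullet> v) *\<^sub>R axis k 1) $ i" .
qed

text \<open>Linearity in row \<open>k\<close>: when \<open>w\<close> is expanded in the standard
  basis, the \<open>k\<close>-th term gives \<open>w $ k\<close> and every other term has two equal
  rows.\<close>

lemma det_elementary:
  fixes w :: "real^'n"
  shows "det (elementary k w) = 1 + w $ k"
proof -
  have id: "(\<chi> i. if i = k then axis k 1 else axis i (1::real)) = (mat 1 :: real^'n^'n)"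
    by (simp add: vec_eq_iff mat_def axis_def)
  have "det (\<chi> i. if i = k then w else axis i (1::real))
      = det (\<chi> i. if i = k then (\<Sum>j\<in>UNIV. w $ j *s axis j 1) else axis i (1::real))"
    by (simp only: basis_expansion)
  also have "\<dots> = (\<Sum>j\<in>UNIV. det (\<chi> i. if i = k then w $ j *s axis j 1 else axis i (1::real)))"
    by (rule det_linear_row_sum) simp
  also have "\<dots> = (\<Sum>j\<in>UNIV. w $ j * det (\<chi> i. if i = k then axis j 1 else axis i (1::real)))"
    by (intro sum.cong refl det_row_mul)
  also have "\<dots> = (\<Sum>j\<in>UNIV. if j = k then w $ k else 0)"
  proof (intro sum.cong refl)
    fix j
    show "w $ j * det (\<chi> i. if i = k then axis j 1 else axis i (1::real)) = (if j = k then w $ k else 0)"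
    proof (cases "j = k")
      case True
      then show ?thesis by (simp add: id cong: if_cong)
    next
      case False
      have "det (\<chi> i. if i = k then axis j 1 else axis i (1::real)) = 0"
        by (rule det_identical_rows[OF False]) (use False in \<open>simp add: row_def vec_eq_iff\<close>)
      then show ?thesis using False by simp
    qed
  qed
  finally have "det (\<chi> i. if i = k then w else axis i (1::real)) = w $ k" by simp
  then show ?thesis
    unfolding elementary_def by (simp add: det_row_add id)
qed

text \<open>The map moves points only along \<open>axis k 1\<close>, and on such a line it is affine
  in the parameter with slope \<open>1 + w $ k\<close>. The slab weight \<omega> passes from lines
  to the whole space.\<close>

lemma volume_scaling_elementary:
  fixes w :: "real^'n"
  assumes nz: "1 + w $ k \<noteq> 0"
  shows "volume_scaling (elementary k w)"
  unfolding volume_scaling_def det_elementary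
proof (intro conjI allI impI nz)
  fix g :: "real^'n \<Rightarrow> ennreal" assume [measurable]: "g \<in> borel_measurable borel"
  let ?d = "axis k 1 :: real^'n"
  have [measurable]: "(\<lambda>v. g (elementary k w *v v)) \<in> borel_measurable borel" by measurable
  obtain \<omega> :: "real^'n \<Rightarrow> ennreal" where [measurable]: "\<omega> \<in> borel_measurable borel"
    and \<omega>: "\<And>x. line_integral ?d \<omega> x = 1"
    using transversal_weight[of ?d] by (metis axis_eq_0_iff zero_neq_one)
  have line: "line_integral ?d (\<lambda>v. g (elementary k w *v v)) v = ennreal (1 / \<bar>1 + w $ k\<bar>) * line_integral ?d g v" for v
  proof -
    have "line_integral ?d g v
        = ennreal \<bar>1 + w $ k\<bar> * (\<integral>\<^sup>+ s. g (v + (w \<bullet> v + (1 + w $ k) * s) *\<^sub>R ?d) \<partial>lborel)"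
      unfolding line_integral_def
      by (subst nn_integral_real_affine[where c = "1 + w $ k" and t = "w \<bullet> v"]) (use nz in auto)
    also have "(\<integral>\<^sup>+ s. g (v + (w \<bullet> v + (1 + w $ k) * s) *\<^sub>R ?d) \<partial>lborel)
        = line_integral ?d (\<lambda>v. g (elementary k w *v v)) v"
      unfolding line_integral_def elementary_mult
      by (intro nn_integral_cong arg_cong[of _ _ g])
        (simp add: inner_add_right inner_axis algebra_simps)
    finally show ?thesis
      using nz by (simp add: mult.assoc[symmetric] ennreal_mult[symmetric])
  qed
  have "(\<integral>\<^sup>+ v. g (elementary k w *v v) \<partial>lborel) = (\<integral>\<^sup>+ v. \<omega> v * line_integral ?d (\<lambda>v. g (elementary k w *v v)) v \<partial>lborel)"
    by (subst nn_integral_lines_swap) (auto simp: \<omega>)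
  also have "\<dots> = (\<integral>\<^sup>+ v. ennreal (1 / \<bar>1 + w $ k\<bar>) * (\<omega> v * line_integral ?d g v) \<partial>lborel)"
    unfolding line by (simp add: mult.left_commute)
  also have "\<dots> = ennreal (1 / \<bar>1 + w $ k\<bar>) * (\<integral>\<^sup>+ v. \<omega> v * line_integral ?d g v \<partial>lborel)"
    by (rule nn_integral_cmult) measurable
  also have "(\<integral>\<^sup>+ v. \<omega> v * line_integral ?d g v \<partial>lborel) = (\<integral>\<^sup>+ v. g v \<partial>lborel)"
    by (subst nn_integral_lines_swap) (auto simp: \<omega>)
  finally show "(\<integral>\<^sup>+ v. g (elementary k w *v v) \<partial>lborel) = ennreal (1 / \<bar>1 + w $ k\<bar>) * (\<integral>\<^sup>+ v. g v \<partial>lborel)" .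
qed

lemma sym_bilinear:
  fixes K :: "real^'n^'n"
  assumes "transpose K = K"
  shows "x \<bullet> (K *v y) = y \<bullet> (K *v x)"
  by (metis assms dot_lmul_matrix inner_commute transpose_matrix_vector)

text \<open>Gram-Schmidt for the inner product given by \<open>K\<close>, each step being right
  multiplication by one elementary matrix.\<close>

lemma congruence_to_identity:
  fixes K :: "real^'n^'n"
  assumes K: "sym_pos_def K"
  obtains B where "volume_scaling B" "transpose B ** K ** B = mat 1"
proof -
  let ?e = "\<lambda>i. axis i 1 :: real^'n"
  let ?q = "\<lambda>B i j. (B *v ?e i) \<bullet> (K *v (B *v ?e j))"
  have sym: "x \<bullet> (K *v y) = y \<bullet> (K *v x)" for x y
    using K by (intro sym_bilinear) (simp add: sym_pos_def_def)
  \<comment> \<open>The index \<open>j\<close> is unrestricted: processed columns are already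
    \<open>K\<close>-orthogonal to the unprocessed ones, so later steps leave them
    unchanged.\<close>
  have "\<exists>B. volume_scaling B \<and> (\<forall>i\<in>A. \<forall>j. ?q B i j = (if i = j then 1 else 0))" for A :: "'n set"
  proof (induction rule: finite_induct[OF finite])
    case 1
    then show ?case using volume_scaling_id by auto
  next
    case (2 k A)
    then obtain B where B: "volume_scaling B"
      and q: "\<And>i j. i \<in> A \<Longrightarrow> ?q B i j = (if i = j then 1 else 0)" by auto
    define a where "a = ?q B k k"
    have "B *v ?e k \<noteq> 0"
    proof
      assume 0: "B *v ?e k = 0"
      have "invertible B" using B by (simp add: volume_scaling_def invertible_det_nz)
      then obtain B' where "B' ** B = mat 1" by (auto simp: invertible_def)
      then have "?e k = B' *v (B *v ?e k)" by (simp add: matrix_vector_mul_assoc)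
      with 0 show False by (simp add: axis_eq_0_iff)
    qed
    then have a: "0 < a" using K by (simp add: a_def sym_pos_def_def)
    \<comment> \<open>The entry at \<open>k\<close> rescales column \<open>k\<close> to unit length;
      the entry at any other \<open>j\<close> removes from column \<open>j\<close> its component
      along column \<open>k\<close>, and is 0 for \<open>j\<close> in \<open>A\<close>.\<close>
    define w where "w = (\<chi> j. if j = k then 1 / sqrt a - 1 else - ?q B j k / a)"
    define S where "S = elementary k w"
    have "volume_scaling S"
      unfolding S_def using a by (intro volume_scaling_elementary) (simp add: w_def)
    then have BS: "volume_scaling (B ** S)" using B volume_scaling_mult by blast
    have b: "(B ** S) *v ?e j = B *v ?e j + w $ j *\<^sub>R (B *v ?e k)" for j
      by (simp add: S_def matrix_vector_mul_assoc[symmetric] elementary_mult matrix_vector_right_distrib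
          inner_axis matrix_vector_mult_scaleR)
    have q': "?q (B ** S) i j = ?q B i j + w $ j * ?q B i k + w $ i * ?q B k j + w $ i * w $ j * a" for i j
      by (simp add: b a_def inner_add_left inner_add_right matrix_vector_right_distrib
          matrix_vector_mult_scaleR algebra_simps)
    have "?q (B ** S) i j = (if i = j then 1 else 0)" if "i \<in> insert k A" for i j
    proof (cases "i = k")
      case True
      show ?thesis
      proof (cases "j = k")
        case True
        have "1 / sqrt a * (1 / sqrt a) * a = 1" using a by (simp add: field_simps)
        moreover have "?q (B ** S) i j = (1 + w $ k) * (1 + w $ k) * a"
          unfolding q' using \<open>i = k\<close> True by (simp add: a_def algebra_simps)
        ultimately show ?thesis using True \<open>i = k\<close> by (simp add: w_def)
      next
        case False
        have "?q (B ** S) i j = (1 + w $ k) * (?q B j k + w $ j * a)"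
          unfolding q' using \<open>i = k\<close> sym[of "B *v ?e k" "B *v ?e j"] by (simp add: a_def algebra_simps)
        also have "\<dots> = 0" using False a by (simp add: w_def)
        finally show ?thesis using \<open>i = k\<close> False by simp
      qed
    next
      case False
      then have i: "i \<in> A" "i \<noteq> k" using that by auto
      have "w $ i = 0" using i q[of i k] by (simp add: w_def)
      then show ?thesis unfolding q' using i q[of i j] q[of i k] by simp
    qed
    then show ?case using BS by blast
  qed
  from this[of UNIV] obtain B where B: "volume_scaling B" and q: "\<And>i j. ?q B i j = (if i = j then 1 else 0)"
    by auto
  have "(transpose B ** K ** B) $ i $ j = ?q B i j" for i j
  proof -
    have "(transpose B ** K ** B) $ i $ j = ?e i \<bullet> ((transpose B ** K ** B) *v ?e j)"
      by (simp add: inner_axis' matrix_vector_mul_component inner_axis)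
    also have "\<dots> = ?e i \<bullet> (transpose B *v (K *v (B *v ?e j)))"
      by (simp add: matrix_vector_mul_assoc[symmetric])
    also have "\<dots> = ?q B i j"
      by (metis dot_lmul_matrix vector_transpose_matrix)
    finally show ?thesis .
  qed
  then have "transpose B ** K ** B = mat 1"
    by (simp add: vec_eq_iff mat_def q)
  with B show ?thesis using that by blast
qed

section \<open>Marginals over the parameter\<close>

lemma AE_marginal_finite:
  fixes h :: "'e::euclidean_space \<times> 'd::euclidean_space \<Rightarrow> ennreal"
  assumes [measurable]: "h \<in> borel_measurable borel" and fin: "(\<integral>\<^sup>+ x. h x \<partial>lborel) < top"
  shows "AE x in (lborel :: ('e \<times> 'd) measure). (\<integral>\<^sup>+ t. h (t, snd x) \<partial>lborel) < top"
proof -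
  have [measurable]: "h \<in> borel_measurable (borel \<Otimes>\<^sub>M borel)"
    unfolding borel_prod by measurable
  have "(\<integral>\<^sup>+ y. (\<integral>\<^sup>+ t. h (t, y) \<partial>lborel) \<partial>lborel) = (\<integral>\<^sup>+ x. h x \<partial>(lborel \<Otimes>\<^sub>M lborel))"
    by (rule lborel_pair.nn_integral_snd) measurable
  then have "(\<integral>\<^sup>+ y. (\<integral>\<^sup>+ t. h (t, y) \<partial>lborel) \<partial>lborel) < top"
    using fin by (simp add: lborel_prod)
  then have "AE y in lborel. (\<integral>\<^sup>+ t. h (t, y) \<partial>lborel) \<noteq> \<infinity>"
    by (intro nn_integral_noteq_infinite) auto
  then have "AE t in (lborel :: 'e measure). AE y in lborel. (\<integral>\<^sup>+ t'. h (t', snd (t, y)) \<partial>lborel) < top"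
    by (simp add: less_top)
  then have "AE x in (lborel :: 'e measure) \<Otimes>\<^sub>M lborel. (\<integral>\<^sup>+ t. h (t, snd x) \<partial>lborel) < top"
    by (rule lborel_pair.AE_pair_measure[rotated]) measurable
  then show ?thesis unfolding lborel_prod .
qed

lemma AE_marginal_pos:
  fixes h :: "'e::euclidean_space \<times> 'd::euclidean_space \<Rightarrow> ennreal"
  assumes [measurable]: "h \<in> borel_measurable borel"
  shows "AE x in lborel. 0 < h x \<longrightarrow> 0 < (\<integral>\<^sup>+ t. h (t, snd x) \<partial>lborel)"
proof -
  have [measurable]: "h \<in> borel_measurable (borel \<Otimes>\<^sub>M borel)"
    unfolding borel_prod by measurable
  have "AE y in lborel. AE t in lborel. 0 < h (t, y) \<longrightarrow> 0 < (\<integral>\<^sup>+ t. h (t, y) \<partial>lborel)"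
  proof (rule AE_I2)
    fix y
    show "AE t in lborel. 0 < h (t, y) \<longrightarrow> 0 < (\<integral>\<^sup>+ t. h (t, y) \<partial>lborel)"
    proof (cases "(\<integral>\<^sup>+ t. h (t, y) \<partial>lborel) = 0")
      case True
      then have "AE t in lborel. h (t, y) = 0"
        by (subst (asm) nn_integral_0_iff_AE) auto
      then show ?thesis by eventually_elim auto
    qed (simp add: zero_less_iff_neq_zero)
  qed
  moreover have "(AE t in lborel. AE y in lborel. 0 < h (t, y) \<longrightarrow> 0 < (\<integral>\<^sup>+ t. h (t, y) \<partial>lborel))
      \<longleftrightarrow> (AE y in lborel. AE t in lborel. 0 < h (t, y) \<longrightarrow> 0 < (\<integral>\<^sup>+ t. h (t, y) \<partial>lborel))"
    by (rule lborel_pair.AE_commute) measurable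
  ultimately have "AE t in (lborel :: 'e measure). AE y in lborel. 0 < h (t, y) \<longrightarrow> 0 < (\<integral>\<^sup>+ t'. h (t', snd (t, y)) \<partial>lborel)"
    by simp
  then have "AE x in (lborel :: 'e measure) \<Otimes>\<^sub>M lborel. 0 < h x \<longrightarrow> 0 < (\<integral>\<^sup>+ t. h (t, snd x) \<partial>lborel)"
    by (rule lborel_pair.AE_pair_measure[rotated]) measurable
  then show ?thesis unfolding lborel_prod .
qed

text \<open>The vectors \<open>B *v i\<close> span the parameter space, so the parameter is
  integrated out while the observation stays fixed. The factor is the Jacobian of
  \<open>B\<close>.\<close>

lemma lines_integral_matrix:
  fixes B :: "real^'n^'n" and g :: "(real^'n) \<times> (real^'m) \<Rightarrow> ennreal"
  assumes [measurable]: "g \<in> borel_measurable borel" and B: "volume_scaling B"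
    and ks: "distinct ks" "set ks = Basis"
  shows "lines_integral (map (\<lambda>i. (B *v i, 0)) ks) g x
    = ennreal (1 / \<bar>det B\<bar>) * (\<integral>\<^sup>+ t. g (t, snd x) \<partial>lborel)"
proof -
  have "lines_integral (map (\<lambda>i. (B *v i, 0)) ks) g x
    = (\<integral>\<^sup>+ z. g (x + (\<Sum>i\<in>Basis. z i *\<^sub>R (B *v i, 0))) \<partial>(\<Pi>\<^sub>M k\<in>Basis. (lborel :: real measure)))"
    unfolding ks(2)[symmetric] by (rule lines_integral_eq_PiM) (use ks in auto)
  also have "\<dots> = (\<integral>\<^sup>+ z. g (x + (B *v (\<Sum>i\<in>Basis. z i *\<^sub>R i), 0)) \<partial>(\<Pi>\<^sub>M k\<in>Basis. (lborel :: real measure)))"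
  proof (intro nn_integral_cong arg_cong[of _ _ g])
    fix z :: "real^'n \<Rightarrow> real"
    have "(\<Sum>i\<in>Basis. z i *\<^sub>R (B *v i, 0 :: real^'m)) = (\<Sum>i\<in>Basis. z i *\<^sub>R (B *v i), 0)"
      by (simp add: prod_eq_iff fst_sum snd_sum)
    also have "(\<Sum>i\<in>Basis. z i *\<^sub>R (B *v i)) = B *v (\<Sum>i\<in>Basis. z i *\<^sub>R i)"
      by (simp add: linear_sum[OF matrix_vector_mul_linear] matrix_vector_mult_scaleR)
    finally show "x + (\<Sum>i\<in>Basis. z i *\<^sub>R (B *v i, 0)) = x + (B *v (\<Sum>i\<in>Basis. z i *\<^sub>R i), 0)" by simp
  qed
  also have "\<dots> = (\<integral>\<^sup>+ v. g (x + (B *v v, 0)) \<partial>distr (\<Pi>\<^sub>M b\<in>Basis. lborel) borel (\<lambda>z. \<Sum>b\<in>Basis. z b *\<^sub>R b))"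
    by (subst nn_integral_distr) auto
  also have "\<dots> = (\<integral>\<^sup>+ v. g (x + (B *v v, 0)) \<partial>lborel)"
    by (simp add: lborel_eq[symmetric])
  also have "\<dots> = ennreal (1 / \<bar>det B\<bar>) * (\<integral>\<^sup>+ v. g (x + (v, 0)) \<partial>lborel)"
    using B unfolding volume_scaling_def
    by (elim conjE allE[of _ "\<lambda>v. g (x + (v, 0))"]) simp
  also have "(\<integral>\<^sup>+ v. g (x + (v, 0)) \<partial>lborel) = (\<integral>\<^sup>+ t. g (t, snd x) \<partial>lborel)"
    using nn_integral_lborel_translate[of "\<lambda>t. g (t, snd x)" "fst x"]
    by (cases x) (simp add: add.commute)
  finally show ?thesis .
qed

text \<open>In the coordinates in which the quadratic form \<open>K\<close> bounding the Fisher information is the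
  identity, the logarithmic Sobolev inequality is applied with unit scale in every direction.\<close>

proposition conditional_entropy_lower_bound:
  fixes f :: "(real^'n) \<times> (real^'m) \<Rightarrow> real" and f' :: "real^'n \<Rightarrow> (real^'n) \<times> (real^'m) \<Rightarrow> real"
    and K :: "real^'n^'n"
  assumes dens: "\<And>v. line_density f (f' v) (v, 0)"
    and I: "\<And>v. integrable lborel (\<lambda>x. (f' v x)\<^sup>2 / f x)"
    and I_le: "\<And>v. (\<integral>x. (f' v x)\<^sup>2 / f x \<partial>lborel) \<le> v \<bullet> (K *v v)"
    and K: "sym_pos_def K"
    and ent: "integrable lborel (\<lambda>x. f x * ln (f x / enn2real (\<integral>\<^sup>+ t. ennreal (f (t, snd x)) \<partial>lborel)))"
  shows "0 < det K"
    and "(\<integral>x. f x * ln (f x / enn2real (\<integral>\<^sup>+ t. ennreal (f (t, snd x)) \<partial>lborel)) \<partial>lborel)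
      \<le> ln (det K) / 2 - real CARD('n) / 2 * ln (2 * pi * exp 1)"
proof -
  interpret line_density f "f' 0" "(0, 0)" by (rule dens)
  have [measurable]: "f \<in> borel_measurable (borel \<Otimes>\<^sub>M borel)"
    unfolding borel_prod by measurable
  let ?p = "\<lambda>x :: (real^'n) \<times> (real^'m). \<integral>\<^sup>+ t. ennreal (f (t, snd x)) \<partial>lborel"
  obtain B where B: "volume_scaling B" and cong: "transpose B ** K ** B = mat 1"
    using congruence_to_identity[OF K] by blast
  have detB: "det B \<noteq> 0" using B by (simp add: volume_scaling_def)
  have dets: "(det B)\<^sup>2 * det K = 1"
    using arg_cong[OF cong, of det] by (simp add: det_mul det_transpose power2_eq_square mult_ac)
  then show detK: "0 < det K"
    by (smt (verit) zero_less_mult_iff zero_le_power2)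
  obtain ks :: "(real^'n) list" where ks: "set ks = Basis" "distinct ks"
    using finite_distinct_list[OF finite_Basis] by blast
  define ds where "ds = map (\<lambda>i. (B *v i, 0 :: real^'m)) ks"
  define g where "g = lines_integral ds (\<lambda>x. ennreal (f x))"
  have g: "g x = ennreal (1 / \<bar>det B\<bar>) * ?p x" for x
    unfolding g_def ds_def by (rule lines_integral_matrix[OF _ B ks(2,1)]) measurable
  \<comment> \<open>The columns of \<open>B\<close> have unit length for \<open>K\<close>, so the
    Fisher information in each direction of \<open>ds\<close> is at most 1.\<close>
  have q: "(B *v i) \<bullet> (K *v (B *v i)) = 1" if "i \<in> Basis" for i
  proof -
    have "(B *v i) \<bullet> (K *v (B *v i)) = i \<bullet> (transpose B ** K ** B *v i)"
      by (metis dot_lmul_matrix matrix_vector_mul_assoc vector_transpose_matrix)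
    then show ?thesis using that by (simp add: cong)
  qed
  have p_fin: "AE x in lborel. ?p x < top"
    by (rule AE_marginal_finite) (simp_all add: total)
  have p_pos: "AE x in lborel. 0 < f x \<longrightarrow> 0 < ?p x"
    using AE_marginal_pos[of "\<lambda>x. ennreal (f x)"] by simp
  \<comment> \<open>Replacing the marginal \<open>?p\<close> by \<open>g\<close> costs the Jacobian;
    the extra \<open>ln \<bar>det B\<bar>\<close> finally becomes
    \<open>- ln (det K) / 2\<close>.\<close>
  have "AE x in lborel. f x * ln (f x / enn2real (g x)) = f x * ln (f x / enn2real (?p x)) + ln \<bar>det B\<bar> * f x"
    using p_pos p_fin
  proof eventually_elim
    case (elim x)
    show ?case
    proof (cases "f x = 0")
      case False
      then have fx: "0 < f x" using nn[of x] by simp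
      then have p: "0 < enn2real (?p x)" using elim by (simp add: enn2real_positive_iff)
      have "f x / enn2real (g x) = (f x / enn2real (?p x)) * \<bar>det B\<bar>"
        using detB by (simp add: g enn2real_mult field_simps)
      then have "ln (f x / enn2real (g x)) = ln (f x / enn2real (?p x)) + ln \<bar>det B\<bar>"
        using fx p detB by (simp add: ln_mult ln_div)
      then show ?thesis by (simp add: algebra_simps)
    qed simp
  qed
  note ae = this
  have [measurable]: "g \<in> borel_measurable borel" unfolding g_def by measurable
  have f_int: "integrable lborel f" and f_val: "(\<integral>x. f x \<partial>lborel) = 1"
    using total nn integral_eq_nn_integral[of f lborel]
    by (auto intro!: integrableI_nonneg)
  let ?E = "\<integral>x. f x * ln (f x / enn2real (?p x)) \<partial>lborel"
  have rhs: "integrable lborel (\<lambda>x. f x * ln (f x / enn2real (?p x)) + ln \<bar>det B\<bar> * f x)"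
    using ent f_int by auto
  have ent': "integrable lborel (\<lambda>x. f x * ln (f x / enn2real (g x)))"
    using integrable_cong_AE[OF _ _ ae] rhs by auto
  have "(\<integral>x. f x * ln (f x / enn2real (g x)) \<partial>lborel) = ?E + ln \<bar>det B\<bar>"
    using integral_cong_AE[OF _ _ ae] ent f_int f_val by (simp add: Bochner_Integration.integral_add)
  moreover have "(\<integral>x. f x * ln (f x / enn2real (g x)) \<partial>lborel)
      \<le> (\<Sum>d\<leftarrow>ds. (\<integral>x. (f' (fst d) x)\<^sup>2 / f x \<partial>lborel) / 2 - 1 - ln (2 * pi) / 2)"
    unfolding g_def
  proof (rule log_sobolev_lines[of ds f "\<lambda>d. f' (fst d)"])
    show "line_density f (f' (fst d)) d" if "d \<in> set ds" for d
      using that dens by (auto simp: ds_def)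
    show "d \<noteq> 0" if d: "d \<in> set ds" for d
    proof -
      obtain i where i: "i \<in> Basis" "d = (B *v i, 0)" using d ks by (auto simp: ds_def)
      have "B *v i \<noteq> 0" using q[OF i(1)] by auto
      then show ?thesis using i by (simp add: prod_eq_iff)
    qed
    show "AE x in lborel. lines_integral ds (\<lambda>x. ennreal (f x)) x < top"
      using p_fin unfolding g_def[symmetric] g by eventually_elim (simp add: ennreal_mult_less_top)
    show "integrable lborel (\<lambda>x. f x * ln (f x / enn2real (lines_integral ds (\<lambda>x. ennreal (f x)) x)))"
      using ent' by (simp add: g_def)
  qed (use I nn total in auto)
  \<comment> \<open>Fisher information 1 contributes 1/2, and 1/2 - 1 = - 1/2 accounts for the
    factor \<open>exp 1\<close> inside the logarithm.\<close>
  moreover have "(\<Sum>d\<leftarrow>ds. (\<integral>x. (f' (fst d) x)\<^sup>2 / f x \<partial>lborel) / 2 - 1 - ln (2 * pi) / 2)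
      \<le> (\<Sum>d\<leftarrow>ds. - 1 / 2 - ln (2 * pi) / 2)"
  proof (rule sum_list_mono)
    fix d assume "d \<in> set ds"
    then obtain i where i: "i \<in> Basis" "d = (B *v i, 0)" using ks by (auto simp: ds_def)
    have "(\<integral>x. (f' (fst d) x)\<^sup>2 / f x \<partial>lborel) \<le> 1"
      using I_le[of "B *v i"] q[OF i(1)] i(2) by simp
    then show "(\<integral>x. (f' (fst d) x)\<^sup>2 / f x \<partial>lborel) / 2 - 1 - ln (2 * pi) / 2 \<le> - 1 / 2 - ln (2 * pi) / 2"
      by simp
  qed
  moreover have "(\<Sum>d\<leftarrow>ds. - 1 / 2 - ln (2 * pi) / 2 :: real) = - real CARD('n) / 2 * ln (2 * pi * exp 1)"
  proof -
    have "length ds = CARD('n)" using ks distinct_card[of ks] by (simp add: ds_def)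
    moreover have "ln (2 * pi * exp 1) = ln (2 * pi) + 1" by (simp add: ln_mult)
    ultimately show ?thesis by (simp add: sum_list_triv algebra_simps add_divide_distrib)
  qed
  moreover have "ln \<bar>det B\<bar> = - ln (det K) / 2"
  proof -
    have "ln (\<bar>det B\<bar> * \<bar>det B\<bar> * det K) = 0"
      using dets by (simp add: power2_eq_square)
    moreover have "ln (\<bar>det B\<bar> * \<bar>det B\<bar> * det K) = ln \<bar>det B\<bar> + ln \<bar>det B\<bar> + ln (det K)"
      using detB detK by (simp add: ln_mult del: abs_mult_self_eq)
    ultimately show ?thesis by simp
  qed
  ultimately show "?E \<le> ln (det K) / 2 - real CARD('n) / 2 * ln (2 * pi * exp 1)"
    by simp
qed

section \<open>The observation model\<close>

locale gaussian_observation =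
  fixes M :: "'a measure"
    and \<Theta> :: "(real^'n) set"
    and p0 :: "real^'n \<Rightarrow> real"
    and u :: "real^'k"
    and F :: "real^'n \<Rightarrow> real^'k \<Rightarrow> real^'m"
    and S :: "real^'n \<Rightarrow> real^'k \<Rightarrow> real^'m^'m"
    and \<theta> :: "'a \<Rightarrow> real^'n"
    and Z Y :: "'a \<Rightarrow> real^'m"
  assumes prob: "prob_space M"
    and \<theta>_in: "\<And>\<omega>. \<omega> \<in> space M \<Longrightarrow> \<theta> \<omega> \<in> \<Theta>"
    and p0_nonneg: "\<And>t. 0 \<le> p0 t"
    and p0_outside: "\<And>t. t \<notin> \<Theta> \<Longrightarrow> p0 t = 0"
    and \<theta>_distributed: "distributed M lborel \<theta> (\<lambda>t. ennreal (p0 t))"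
    and F_smooth: "smooth_near (\<Theta> \<times> UNIV) (\<lambda>(t, v). F t v)"
    and S_pos_def: "\<And>t v. t \<in> \<Theta> \<Longrightarrow> sym_pos_def (S t v)"
    and noise_distributed: "distributed M (lborel \<Otimes>\<^sub>M lborel) (\<lambda>\<omega>. (\<theta> \<omega>, Z \<omega>))
           (\<lambda>(t, z). ennreal (p0 t * gaussian_density z 0 (S t u)))"
    and Y_eq: "\<And>\<omega>. \<omega> \<in> space M \<Longrightarrow> Y \<omega> = F (\<theta> \<omega>) u + Z \<omega>"
    and entropies: "finite_entropies M \<theta> Y p0 F S u"
begin

abbreviation "lik \<equiv> likelihood F S u"

definition f :: "(real^'n) \<times> (real^'m) \<Rightarrow> real" where
  "f x = joint_density p0 F S u (fst x) (snd x)"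

lemma f_eq: "f (t, y) = p0 t * lik t y"
  by (simp add: f_def joint_density_def)

lemma lik_nonneg: "0 \<le> lik t y"
  by (simp add: likelihood_def gaussian_density_def)

lemma lik_pos:
  assumes "t \<in> \<Theta>" shows "0 < lik t y"
proof -
  have "det (S t u) \<noteq> 0"
  proof
    assume "det (S t u) = 0"
    then have "\<not> (\<exists>B. B ** S t u = mat 1)"
      using invertible_det_nz[of "S t u"] by (auto simp: invertible_left_inverse)
    then obtain x where "x \<noteq> 0" "S t u *v x = 0"
      by (auto simp: matrix_left_invertible_ker)
    then show False using S_pos_def[OF assms, of u] by (auto simp: sym_pos_def_def)
  qed
  \<comment> \<open>\<open>powr\<close> with any nonzero base is an exponential, so a nonzero
    determinant already gives positivity.\<close>
  then show ?thesis
    by (simp add: likelihood_def gaussian_density_def)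
qed

lemma f_nonneg: "0 \<le> f x"
  by (cases x) (simp add: f_eq p0_nonneg lik_nonneg)

lemma p0_measurable [measurable]: "p0 \<in> borel_measurable borel"
proof -
  have "(\<lambda>t. ennreal (p0 t)) \<in> borel_measurable lborel"
    using \<theta>_distributed by (simp add: distributed_def)
  then have "(\<lambda>t. enn2real (ennreal (p0 t))) \<in> borel_measurable borel" by simp
  then show ?thesis by (simp add: p0_nonneg)
qed

text \<open>The set \<Theta> need not be measurable, so \<open>F\<close> cannot simply be cut off
  outside it. The slice at \<open>u\<close> of the neighbourhood from \<open>F_smooth\<close> is an
  open set containing \<Theta> on which \<open>F\<close> is continuous.\<close>

lemma mean_extension:
  "\<exists>G. G \<in> borel_measurable borel \<and> (\<forall>t\<in>\<Theta>. G t = F t u)"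
proof -
  obtain W where W: "open W" "\<Theta> \<times> UNIV \<subseteq> W" "\<forall>k. Ck_on k W (\<lambda>(t, v). F t v)"
    using F_smooth by (auto simp: smooth_near_def)
  from W(3) have cont: "continuous_on W (\<lambda>(t, v). F t v)" by (metis Ck_on.simps(1))
  define A where "A = (\<lambda>t. (t, u)) -` W"
  have "open A" unfolding A_def
    using W(1) by (intro continuous_open_vimage continuous_intros)
  then have A: "A \<in> sets borel" by simp
  have "continuous_on A (\<lambda>t. (\<lambda>(t, v). F t v) (t, u))"
    by (rule continuous_on_compose2[OF cont]) (auto intro!: continuous_intros simp: A_def)
  then have "(\<lambda>t. if t \<in> A then F t u else 0) \<in> borel_measurable borel"
    using A by (intro borel_measurable_continuous_on_if) auto
  moreover have "\<Theta> \<subseteq> A" using W(2) by (auto simp: A_def)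
  ultimately show ?thesis by (intro exI[of _ "\<lambda>t. if t \<in> A then F t u else 0"]) auto
qed

definition F' :: "real^'n \<Rightarrow> real^'m" where
  "F' = (SOME G. G \<in> borel_measurable borel \<and> (\<forall>t\<in>\<Theta>. G t = F t u))"

lemma F'_measurable [measurable]: "F' \<in> borel_measurable borel"
  and F'_eq: "t \<in> \<Theta> \<Longrightarrow> F' t = F t u"
  using someI_ex[OF mean_extension] unfolding F'_def by blast+

definition noise :: "(real^'n) \<times> (real^'m) \<Rightarrow> real" where
  "noise x = p0 (fst x) * gaussian_density (snd x) 0 (S (fst x) u)"

lemma noise_nonneg: "0 \<le> noise x"
  by (simp add: noise_def gaussian_density_def p0_nonneg)

lemma noise_measurable [measurable]: "noise \<in> borel_measurable (borel \<Otimes>\<^sub>M borel)"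
proof -
  have "(\<lambda>x. ennreal (noise x)) \<in> borel_measurable (lborel \<Otimes>\<^sub>M lborel)"
    using noise_distributed by (simp add: distributed_def noise_def case_prod_beta')
  then have "(\<lambda>x. ennreal (noise x)) \<in> borel_measurable (borel \<Otimes>\<^sub>M borel)"
    by (simp cong: measurable_cong_sets)
  then have "(\<lambda>x. enn2real (ennreal (noise x))) \<in> borel_measurable (borel \<Otimes>\<^sub>M borel)" by measurable
  then show ?thesis by (simp add: noise_nonneg)
qed

lemma f_noise: "f (t, y) = noise (t, y - F' t)"
  by (cases "t \<in> \<Theta>")
    (simp_all add: f_eq noise_def likelihood_def gaussian_density_def F'_eq p0_outside)

text \<open>\<open>S\<close> enters \<open>f\<close> through \<open>noise\<close>, whose
  measurability comes with \<open>noise_distributed\<close>; the measurable shear by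
  \<open>F'\<close> carries it over.\<close>

lemma f_measurable_pair [measurable]: "f \<in> borel_measurable (borel \<Otimes>\<^sub>M borel)"
proof -
  have "(\<lambda>x. noise (fst x, snd x - F' (fst x))) \<in> borel_measurable (borel \<Otimes>\<^sub>M borel)" by measurable
  moreover have "f = (\<lambda>x. noise (fst x, snd x - F' (fst x)))"
    by (rule ext) (metis f_noise prod.collapse)
  ultimately show ?thesis by simp
qed

lemma f_measurable [measurable]: "f \<in> borel_measurable borel"
  using f_measurable_pair by (simp add: borel_prod)

section \<open>The joint law of parameter and observation\<close>

lemma \<theta>_measurable [measurable]: "\<theta> \<in> borel_measurable M"
  using distributed_measurable[OF \<theta>_distributed] by simp

lemma \<theta>Z_measurable [measurable]: "(\<lambda>\<omega>. (\<theta> \<omega>, Z \<omega>)) \<in> M \<rightarrow>\<^sub>M borel \<Otimes>\<^sub>M borel"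
  using distributed_measurable[OF noise_distributed] by (simp cong: measurable_cong_sets)

lemma Y_eq': "\<omega> \<in> space M \<Longrightarrow> Y \<omega> = F' (\<theta> \<omega>) + Z \<omega>"
  by (simp add: Y_eq F'_eq \<theta>_in)

lemma Y_measurable [measurable]: "Y \<in> borel_measurable M"
proof -
  have "(\<lambda>\<omega>. snd (\<theta> \<omega>, Z \<omega>)) \<in> borel_measurable M"
    by (rule measurable_compose[OF \<theta>Z_measurable]) measurable
  then have [measurable]: "Z \<in> borel_measurable M" by simp
  have "(\<lambda>\<omega>. F' (\<theta> \<omega>) + Z \<omega>) \<in> borel_measurable M" by measurable
  then show ?thesis by (subst measurable_cong[OF Y_eq'])
qed

text \<open>For a fixed parameter the observation is a translate of the noise, so Tonelli and
  translation invariance transfer the law of the pair with \<open>Z\<close> to the pair with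
  \<open>Y\<close>.\<close>

lemma nn_integral_joint:
  assumes [measurable]: "\<phi> \<in> borel_measurable (borel \<Otimes>\<^sub>M borel)"
  shows "(\<integral>\<^sup>+ \<omega>. \<phi> (\<theta> \<omega>, Y \<omega>) \<partial>M) = (\<integral>\<^sup>+ x. ennreal (f x) * \<phi> x \<partial>(lborel \<Otimes>\<^sub>M lborel))"
proof -
  have "(\<integral>\<^sup>+ \<omega>. \<phi> (\<theta> \<omega>, Y \<omega>) \<partial>M) = (\<integral>\<^sup>+ \<omega>. (\<lambda>x. \<phi> (fst x, F' (fst x) + snd x)) (\<theta> \<omega>, Z \<omega>) \<partial>M)"
    by (intro nn_integral_cong) (simp add: Y_eq')
  also have "\<dots> = (\<integral>\<^sup>+ x. ennreal (noise x) * \<phi> (fst x, F' (fst x) + snd x) \<partial>(lborel \<Otimes>\<^sub>M lborel))"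
    by (subst distributed_nn_integral[OF noise_distributed, symmetric])
      (auto simp: noise_def case_prod_beta')
  also have "\<dots> = (\<integral>\<^sup>+ t. (\<integral>\<^sup>+ z. ennreal (noise (t, z)) * \<phi> (t, F' t + z) \<partial>lborel) \<partial>lborel)"
    by (subst lborel.nn_integral_fst[symmetric]) auto
  also have "\<dots> = (\<integral>\<^sup>+ t. (\<integral>\<^sup>+ y. ennreal (f (t, y)) * \<phi> (t, y) \<partial>lborel) \<partial>lborel)"
  proof (rule nn_integral_cong)
    fix t :: "real^'n"
    show "(\<integral>\<^sup>+ z. ennreal (noise (t, z)) * \<phi> (t, F' t + z) \<partial>lborel)
        = (\<integral>\<^sup>+ y. ennreal (f (t, y)) * \<phi> (t, y) \<partial>lborel)"
      using nn_integral_lborel_translate[of "\<lambda>y. ennreal (f (t, y)) * \<phi> (t, y)" "F' t"]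
      by (simp add: f_noise add.commute)
  qed
  also have "\<dots> = (\<integral>\<^sup>+ x. ennreal (f x) * \<phi> x \<partial>(lborel \<Otimes>\<^sub>M lborel))"
    by (subst lborel.nn_integral_fst[symmetric]) auto
  finally show ?thesis .
qed

lemma law_joint: "distr M (borel \<Otimes>\<^sub>M borel) (\<lambda>\<omega>. (\<theta> \<omega>, Y \<omega>)) = density (lborel \<Otimes>\<^sub>M lborel) (\<lambda>x. ennreal (f x))"
proof (rule measure_eqI)
  fix X assume "X \<in> sets (distr M (borel \<Otimes>\<^sub>M borel) (\<lambda>\<omega>. (\<theta> \<omega>, Y \<omega>)))"
  then have [measurable]: "X \<in> sets (borel \<Otimes>\<^sub>M borel)" by simp
  have "emeasure (distr M (borel \<Otimes>\<^sub>M borel) (\<lambda>\<omega>. (\<theta> \<omega>, Y \<omega>))) X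
      = (\<integral>\<^sup>+ x. indicator X x \<partial>distr M (borel \<Otimes>\<^sub>M borel) (\<lambda>\<omega>. (\<theta> \<omega>, Y \<omega>)))"
    by simp
  also have "\<dots> = (\<integral>\<^sup>+ \<omega>. indicator X (\<theta> \<omega>, Y \<omega>) \<partial>M)"
    by (rule nn_integral_distr) measurable
  also have "\<dots> = (\<integral>\<^sup>+ x. ennreal (f x) * indicator X x \<partial>(lborel \<Otimes>\<^sub>M lborel))"
    by (rule nn_integral_joint) measurable
  also have "\<dots> = emeasure (density (lborel \<Otimes>\<^sub>M lborel) (\<lambda>x. ennreal (f x))) X"
    by (subst emeasure_density) auto
  finally show "emeasure (distr M (borel \<Otimes>\<^sub>M borel) (\<lambda>\<omega>. (\<theta> \<omega>, Y \<omega>))) X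
      = emeasure (density (lborel \<Otimes>\<^sub>M lborel) (\<lambda>x. ennreal (f x))) X" .
qed (simp cong: sets_pair_measure_cong)

lemma
  fixes h :: "(real^'n) \<times> (real^'m) \<Rightarrow> real"
  assumes [measurable]: "h \<in> borel_measurable (borel \<Otimes>\<^sub>M borel)"
  shows integrable_joint: "integrable M (\<lambda>\<omega>. h (\<theta> \<omega>, Y \<omega>)) \<longleftrightarrow> integrable lborel (\<lambda>x. f x * h x)"
    and integral_joint: "(\<integral>\<omega>. h (\<theta> \<omega>, Y \<omega>) \<partial>M) = (\<integral>x. f x * h x \<partial>lborel)"
proof -
  have [measurable]: "h \<in> borel_measurable borel" using assms by (simp add: borel_prod)
  have "integrable M (\<lambda>\<omega>. h (\<theta> \<omega>, Y \<omega>)) \<longleftrightarrow> integrable (distr M (borel \<Otimes>\<^sub>M borel) (\<lambda>\<omega>. (\<theta> \<omega>, Y \<omega>))) h"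
    by (subst integrable_distr_eq) auto
  then show "integrable M (\<lambda>\<omega>. h (\<theta> \<omega>, Y \<omega>)) \<longleftrightarrow> integrable lborel (\<lambda>x. f x * h x)"
    unfolding law_joint by (subst (asm) integrable_density) (auto simp: f_nonneg lborel_prod)
  have "(\<integral>\<omega>. h (\<theta> \<omega>, Y \<omega>) \<partial>M) = integral\<^sup>L (distr M (borel \<Otimes>\<^sub>M borel) (\<lambda>\<omega>. (\<theta> \<omega>, Y \<omega>))) h"
    by (subst integral_distr) auto
  then show "(\<integral>\<omega>. h (\<theta> \<omega>, Y \<omega>) \<partial>M) = (\<integral>x. f x * h x \<partial>lborel)"
    unfolding law_joint by (subst (asm) integral_density) (auto simp: f_nonneg lborel_prod)
qed

lemma f_total: "(\<integral>\<^sup>+ x. ennreal (f x) \<partial>lborel) = 1"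
  using nn_integral_joint[of "\<lambda>_. 1"] prob_space.emeasure_space_1[OF prob] by (simp add: lborel_prod)

lemma f_integrable: "integrable lborel f"
  using f_total f_nonneg by (intro integrableI_nonneg) auto

lemma f_integral: "(\<integral>x. f x \<partial>lborel) = 1"
  using f_total f_nonneg integral_eq_nn_integral[of f lborel] by simp

text \<open>This includes the divergent case, where the Bochner integral and
  \<open>enn2real top\<close> are both 0.\<close>

lemma evidence_eq: "evidence p0 F S u y = enn2real (\<integral>\<^sup>+ t. ennreal (f (t, y)) \<partial>lborel)"
  unfolding evidence_def f_eq[symmetric]
  by (intro integral_eq_nn_integral) (auto simp: f_nonneg)

abbreviation "evid \<equiv> evidence p0 F S u"

lemma ev_measurable [measurable]: "evid \<in> borel_measurable borel"
  unfolding evidence_eq by measurable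

lemma ev_nonneg: "0 \<le> evid y"
  by (simp add: evidence_eq)

lemma posterior_eq: "posterior p0 F S u t y = f (t, y) / evid y"
  by (simp add: posterior_def f_eq)

lemma posterior_integrable: "integrable lborel (\<lambda>x. f x * ln (f x / evid (snd x)))"
  and posterior_entropy_eq:
    "posterior_entropy M \<theta> Y p0 F S u = - (\<integral>x. f x * ln (f x / evid (snd x)) \<partial>lborel)"
proof -
  let ?h = "\<lambda>x. - ln (f x / evid (snd x))"
  have "integrable M (\<lambda>\<omega>. ?h (\<theta> \<omega>, Y \<omega>))"
    using entropies by (simp add: finite_entropies_def posterior_eq)
  then have "integrable lborel (\<lambda>x. f x * ?h x)"
    by (subst (asm) integrable_joint) auto
  then show "integrable lborel (\<lambda>x. f x * ln (f x / evid (snd x)))" by simp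
  have "posterior_entropy M \<theta> Y p0 F S u = (\<integral>\<omega>. ?h (\<theta> \<omega>, Y \<omega>) \<partial>M)"
    by (simp add: posterior_entropy_def posterior_eq)
  also have "\<dots> = (\<integral>x. f x * ?h x \<partial>lborel)"
    by (rule integral_joint) measurable
  finally show "posterior_entropy M \<theta> Y p0 F S u = - (\<integral>x. f x * ln (f x / evid (snd x)) \<partial>lborel)" by simp
qed

lemma ev_total: "(\<integral>\<^sup>+ y. ennreal (evid y) \<partial>lborel) \<le> 1"
proof -
  have "(\<integral>\<^sup>+ y. ennreal (evid y) \<partial>lborel) \<le> (\<integral>\<^sup>+ y. (\<integral>\<^sup>+ t. ennreal (f (t, y)) \<partial>lborel) \<partial>lborel)"
    unfolding evidence_eq by (intro nn_integral_mono) (simp add: ennreal_enn2real_if)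
  also have "\<dots> = (\<integral>\<^sup>+ x. ennreal (f x) \<partial>(lborel \<Otimes>\<^sub>M lborel))"
    by (rule lborel_pair.nn_integral_snd) measurable
  finally show ?thesis by (simp add: lborel_prod f_total)
qed

lemma AE_ev_pos: "AE x in lborel. 0 < f x \<longrightarrow> 0 < evid (snd x)"
proof -
  have "AE x in (lborel :: ((real^'n) \<times> (real^'m)) measure). (\<integral>\<^sup>+ t. ennreal (f (t, snd x)) \<partial>lborel) < top"
    by (rule AE_marginal_finite[of "\<lambda>x. ennreal (f x)"]) (simp_all add: f_total)
  moreover have "AE x in lborel. 0 < ennreal (f x) \<longrightarrow> 0 < (\<integral>\<^sup>+ t. ennreal (f (t, snd x)) \<partial>lborel)"
    by (rule AE_marginal_pos[of "\<lambda>x. ennreal (f x)"]) measurable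
  ultimately show ?thesis
    by eventually_elim (simp add: evidence_eq enn2real_positive_iff)
qed

text \<open>Gibbs' inequality against the Gaussian with mean \<open>e y\<close> and covariance \<open>\<sigma>\<^sup>2 1\<close>.\<close>

lemma posterior_entropy_le:
  fixes e :: "real^'m \<Rightarrow> real^'n"
  assumes [measurable]: "e \<in> borel_measurable borel" and \<sigma>: "0 < \<sigma>"
    and V: "integrable lborel (\<lambda>x. f x * (norm (fst x - e (snd x)))\<^sup>2)"
  shows "posterior_entropy M \<theta> Y p0 F S u
    \<le> real CARD('n) / 2 * ln (2 * pi * \<sigma>\<^sup>2) + (\<integral>x. f x * (norm (fst x - e (snd x)))\<^sup>2 \<partial>lborel) / (2 * \<sigma>\<^sup>2)"
proof -
  \<comment> \<open>A product over \<open>Basis\<close> reduces the total mass and the logarithm to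
    one-dimensional normal densities.\<close>
  define q where "q x = (\<Prod>b\<in>Basis. normal_density (e (snd x) \<bullet> b) \<sigma> (fst x \<bullet> b))" for x :: "(real^'n) \<times> (real^'m)"
  have [measurable]: "q \<in> borel_measurable (borel \<Otimes>\<^sub>M borel)"
    unfolding q_def normal_density_def by measurable
  have [measurable]: "q \<in> borel_measurable borel"
    using \<open>q \<in> borel_measurable (borel \<Otimes>\<^sub>M borel)\<close> by (simp add: borel_prod)
  have q_pos: "0 < q x" for x
    unfolding q_def using \<sigma> by (intro prod_pos) (simp add: normal_density_pos)
  have q_total: "(\<integral>\<^sup>+ t. ennreal (q (t, y)) \<partial>lborel) = 1" for y
  proof -
    have "(\<integral>\<^sup>+ t. ennreal (q (t, y)) \<partial>lborel)
        = (\<integral>\<^sup>+ t. (\<Prod>b\<in>Basis. ennreal (normal_density (e y \<bullet> b) \<sigma> (t \<bullet> b))) \<partial>lborel)"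
      using \<sigma> by (simp add: q_def prod_ennreal)
    also have "\<dots> = (\<Prod>b\<in>Basis. (\<integral>\<^sup>+ x. ennreal (normal_density (e y \<bullet> b) \<sigma> x) \<partial>lborel))"
      by (rule nn_integral_lborel_prod) auto
    also have "\<dots> = 1"
      using \<sigma> by (intro prod.neutral ballI) (simp add: nn_integral_eq_integral)
    finally show ?thesis .
  qed
  have ln_q: "ln (q x) = - (real CARD('n) / 2 * ln (2 * pi * \<sigma>\<^sup>2)) - (norm (fst x - e (snd x)))\<^sup>2 / (2 * \<sigma>\<^sup>2)" for x
  proof -
    have "ln (normal_density m \<sigma> a) = - (ln (2 * pi * \<sigma>\<^sup>2) / 2) - (a - m)\<^sup>2 / (2 * \<sigma>\<^sup>2)" for m a
      unfolding normal_density_def using \<sigma> by (simp add: ln_mult ln_div ln_sqrt)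
    then have "ln (q x) = (\<Sum>b\<in>Basis. - (ln (2 * pi * \<sigma>\<^sup>2) / 2) - (fst x \<bullet> b - e (snd x) \<bullet> b)\<^sup>2 / (2 * \<sigma>\<^sup>2))"
      unfolding q_def using \<sigma> by (subst ln_prod) (simp_all add: less_imp_neq[OF normal_density_pos, symmetric])
    also have "\<dots> = - (real CARD('n) / 2 * ln (2 * pi * \<sigma>\<^sup>2))
        - (\<Sum>b\<in>Basis. ((fst x - e (snd x)) \<bullet> b)\<^sup>2) / (2 * \<sigma>\<^sup>2)"
      by (simp add: sum_subtractf sum_divide_distrib inner_diff_left)
    also have "(\<Sum>b\<in>Basis. ((fst x - e (snd x)) \<bullet> b)\<^sup>2) = (norm (fst x - e (snd x)))\<^sup>2"
      using euclidean_inner[of "fst x - e (snd x)" "fst x - e (snd x)"]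
      unfolding power2_norm_eq_inner by (simp add: power2_eq_square)
    finally show ?thesis .
  qed
  \<comment> \<open>The comparison density divided by the posterior. Its expectation is at most 1,
    since \<open>q\<close> has mass 1 in the parameter and the evidence has mass at most 1.\<close>
  define r where "r x = (if f x = 0 then 0 else q x * evid (snd x) / f x)" for x
  have [measurable]: "r \<in> borel_measurable (borel \<Otimes>\<^sub>M borel)" unfolding r_def by measurable
  have r_nn: "0 \<le> r x" for x
    using q_pos[of x] f_nonneg[of x] ev_nonneg[of "snd x"] by (simp add: r_def)
  have fr: "f x * r x \<le> q x * evid (snd x)" for x
    using q_pos[of x] ev_nonneg[of "snd x"] by (simp add: r_def)
  have "(\<integral>\<^sup>+ x. ennreal (f x * r x) \<partial>(lborel \<Otimes>\<^sub>M lborel))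
      \<le> (\<integral>\<^sup>+ x. ennreal (q x) * ennreal (evid (snd x)) \<partial>(lborel \<Otimes>\<^sub>M lborel))"
    using fr q_pos ev_nonneg
    by (intro nn_integral_mono) (auto simp: ennreal_mult[symmetric] less_imp_le intro!: ennreal_leI)
  also have "\<dots> = (\<integral>\<^sup>+ y. (\<integral>\<^sup>+ t. ennreal (q (t, y)) * ennreal (evid y) \<partial>lborel) \<partial>lborel)"
    by (subst lborel_pair.nn_integral_snd[symmetric]) auto
  also have "\<dots> = (\<integral>\<^sup>+ y. ennreal (evid y) \<partial>lborel)"
    by (simp add: nn_integral_multc q_total)
  also have "\<dots> \<le> 1" by (rule ev_total)
  finally have fr_le: "(\<integral>\<^sup>+ x. ennreal (f x * r x) \<partial>lborel) \<le> 1" by (simp add: lborel_prod)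
  have [measurable]: "r \<in> borel_measurable borel"
    using \<open>r \<in> borel_measurable (borel \<Otimes>\<^sub>M borel)\<close> by (simp add: borel_prod)
  have fr_int: "integrable lborel (\<lambda>x. f x * r x)"
    using fr_le f_nonneg r_nn by (intro integrableI_nonneg) (auto simp: less_top[symmetric] top_unique)
  have fr_val: "(\<integral>x. f x * r x \<partial>lborel) \<le> 1"
    using fr_le fr_int f_nonneg r_nn by (simp add: nn_integral_eq_integral)
  let ?C = "real CARD('n) / 2 * ln (2 * pi * \<sigma>\<^sup>2)"
  let ?v = "\<lambda>x. (norm (fst x - e (snd x)))\<^sup>2"
  have pt: "f x * (- ln (f x / evid (snd x))) \<le> f x * ?C + f x * ?v x / (2 * \<sigma>\<^sup>2) + f x * r x - f x"
    if "0 < f x \<longrightarrow> 0 < evid (snd x)" for x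
  proof (cases "f x = 0")
    case False
    then have pos: "0 < f x" "0 < evid (snd x)" using f_nonneg[of x] that by auto
    have "0 < r x" using pos q_pos[of x] by (simp add: r_def)
    have "- ln (f x / evid (snd x)) = ln (r x) - ln (q x)"
      using pos q_pos[of x] by (simp add: r_def ln_mult ln_div)
    also have "\<dots> \<le> (r x - 1) + ?C + ?v x / (2 * \<sigma>\<^sup>2)"
      using ln_le_minus_one[OF \<open>0 < r x\<close>] by (simp add: ln_q)
    finally have "f x * (- ln (f x / evid (snd x))) \<le> f x * ((r x - 1) + ?C + ?v x / (2 * \<sigma>\<^sup>2))"
      using pos by (intro mult_left_mono) auto
    then show ?thesis by (simp add: algebra_simps)
  qed simp
  have "posterior_entropy M \<theta> Y p0 F S u = (\<integral>x. f x * (- ln (f x / evid (snd x))) \<partial>lborel)"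
    by (simp add: posterior_entropy_eq)
  also have "\<dots> \<le> (\<integral>x. f x * ?C + f x * ?v x / (2 * \<sigma>\<^sup>2) + f x * r x - f x \<partial>lborel)"
    using posterior_integrable f_integrable V fr_int AE_ev_pos pt
    by (intro integral_mono_AE) (auto elim: eventually_mono)
  also have "\<dots> = ?C + (\<integral>x. f x * ?v x \<partial>lborel) / (2 * \<sigma>\<^sup>2) + (\<integral>x. f x * r x \<partial>lborel) - 1"
    using f_integrable V fr_int
    by (simp add: Bochner_Integration.integral_add Bochner_Integration.integral_diff f_integral)
  finally show ?thesis using fr_val by simp
qed

end

section \<open>Mean square error and Bayesian information\<close>

context gaussian_observation
begin

lemma mse_lower_bound:
  fixes e :: "real^'m \<Rightarrow> real^'n"
  assumes [measurable]: "e \<in> borel_measurable borel"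
  defines "n \<equiv> real CARD('n)"
  shows "ennreal (n * inverse (2 * pi * exp 1) * exp (2 / n * posterior_entropy M \<theta> Y p0 F S u))
    \<le> (\<integral>\<^sup>+\<omega>. ennreal ((norm (\<theta> \<omega> - e (Y \<omega>)))\<^sup>2) \<partial>M)"
proof -
  let ?h = "posterior_entropy M \<theta> Y p0 F S u"
  let ?v = "\<lambda>x. (norm (fst x - e (snd x)))\<^sup>2"
  have eq: "(\<integral>\<^sup>+\<omega>. ennreal ((norm (\<theta> \<omega> - e (Y \<omega>)))\<^sup>2) \<partial>M) = (\<integral>\<^sup>+x. ennreal (f x * ?v x) \<partial>lborel)"
    using nn_integral_joint[of "\<lambda>x. ennreal (?v x)"] by (simp add: ennreal_mult f_nonneg lborel_prod)
  show ?thesis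
  proof (cases "(\<integral>\<^sup>+x. ennreal (f x * ?v x) \<partial>lborel) = top")
    case True
    then show ?thesis by (simp add: eq)
  next
    case False
    have [measurable]: "(\<lambda>x. f x * ?v x) \<in> borel_measurable borel"
      unfolding borel_prod[symmetric] by measurable
    have V: "integrable lborel (\<lambda>x. f x * ?v x)"
      using False f_nonneg by (intro integrableI_nonneg) (auto simp: less_top)
    \<comment> \<open>The variance of the comparison Gaussian is the claimed bound per coordinate.
      Then n/2 ln (2 pi s) = h - n/2, the entropy cancels, and the mean square error is seen to be
      at least n s.\<close>
    define s where "s = inverse (2 * pi * exp 1) * exp (2 / n * ?h)"
    have s: "0 < s" by (simp add: s_def)
    have n: "0 < n" by (simp add: n_def)
    have "2 * pi * s = exp (2 / n * ?h - 1)"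
      by (simp add: s_def exp_diff field_simps)
    then have ln_s: "ln (2 * pi * s) = 2 / n * ?h - 1" by simp
    have "?h \<le> n / 2 * ln (2 * pi * s) + (\<integral>x. f x * ?v x \<partial>lborel) / (2 * s)"
      using posterior_entropy_le[of e "sqrt s", OF assms(1) _ V] s by (simp add: n_def)
    then have "n * s \<le> (\<integral>x. f x * ?v x \<partial>lborel)"
      using n s unfolding ln_s by (simp add: field_simps)
    then have "ennreal (n * s) \<le> ennreal (\<integral>x. f x * ?v x \<partial>lborel)" by (rule ennreal_leI)
    also have "\<dots> = (\<integral>\<^sup>+x. ennreal (f x * ?v x) \<partial>lborel)"
      using V f_nonneg by (intro nn_integral_eq_integral[symmetric]) auto
    finally show ?thesis by (simp add: eq s_def mult.assoc)
  qed
qed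

end

section \<open>Gradients and directional derivatives\<close>

lemma has_derivative_gradient:
  fixes g :: "'a::euclidean_space \<Rightarrow> real"
  assumes "g differentiable (at x)"
  shows "(g has_derivative (\<lambda>h. h \<bullet> gradient g x)) (at x)"
proof -
  obtain g' where g': "(g has_derivative g') (at x)"
    using assms by (auto simp: differentiable_def)
  then have lin: "linear g'" by (rule has_derivative_linear)
  define D where "D = (\<Sum>b\<in>Basis. g' b *\<^sub>R b)"
  have "g' h = h \<bullet> D" for h
  proof -
    have "g' h = g' (\<Sum>b\<in>Basis. (h \<bullet> b) *\<^sub>R b)" by (simp add: euclidean_representation)
    also have "\<dots> = h \<bullet> D"
      by (simp add: linear_sum[OF lin] linear_cmul[OF lin] D_def inner_sum_right mult.commute)
    finally show ?thesis .
  qed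
  then have D: "GDERIV g x :> D" using g' by (simp add: gderiv_def) (metis (no_types, lifting) ext)
  have "E = D" if "GDERIV g x :> E" for E
  proof -
    have "(\<lambda>h. h \<bullet> E) = (\<lambda>h. h \<bullet> D)"
      using that D has_derivative_unique unfolding gderiv_def by blast
    then have "h \<bullet> E = h \<bullet> D" for h by meson
    then show ?thesis using vector_eq_ldot by blast
  qed
  then have "gradient g x = D"
    unfolding gradient_def using D by (intro the_equality)
  then show ?thesis using D by (simp add: gderiv_def)
qed

lemma gradient_eqI:
  fixes g :: "'a::euclidean_space \<Rightarrow> real"
  assumes "(g has_derivative (\<lambda>h. h \<bullet> D)) (at x)"
  shows "gradient g x = D"
proof -
  have "(g has_derivative (\<lambda>h. h \<bullet> gradient g x)) (at x)"
    using assms by (intro has_derivative_gradient) (auto simp: differentiable_def)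
  then have "(\<lambda>h. h \<bullet> gradient g x) = (\<lambda>h. h \<bullet> D)"
    using assms has_derivative_unique by blast
  then have "h \<bullet> gradient g x = h \<bullet> D" for h by meson
  then show ?thesis using vector_eq_ldot by blast
qed

lemma gradient_ln:
  fixes g :: "'a::euclidean_space \<Rightarrow> real"
  assumes "g differentiable (at x)" "0 < g x"
  shows "gradient (\<lambda>s. ln (g s)) x = gradient g x /\<^sub>R g x"
proof (rule gradient_eqI)
  show "((\<lambda>s. ln (g s)) has_derivative (\<lambda>h. h \<bullet> (gradient g x /\<^sub>R g x))) (at x)"
    using has_derivative_gradient[OF assms(1)] assms(2)
    by (auto intro!: derivative_eq_intros simp: divide_inverse)
qed

lemma gradient_mult:
  fixes g h :: "'a::euclidean_space \<Rightarrow> real"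
  assumes "g differentiable (at x)" "h differentiable (at x)"
  shows "gradient (\<lambda>s. g s * h s) x = g x *\<^sub>R gradient h x + h x *\<^sub>R gradient g x"
proof (rule gradient_eqI)
  show "((\<lambda>s. g s * h s) has_derivative (\<lambda>v. v \<bullet> (g x *\<^sub>R gradient h x + h x *\<^sub>R gradient g x))) (at x)"
    using has_derivative_mult[OF has_derivative_gradient[OF assms(1)] has_derivative_gradient[OF assms(2)]]
    by (simp add: inner_add_right mult.commute)
qed

lemma DERIV_gradient_line:
  fixes g :: "'a::euclidean_space \<Rightarrow> real"
  assumes "g differentiable (at x)"
  shows "((\<lambda>s. g (x + s *\<^sub>R v)) has_real_derivative v \<bullet> gradient g x) (at 0)"
proof -
  have g: "(g has_derivative (\<lambda>h. h \<bullet> gradient g x)) (at (x + 0 *\<^sub>R v))"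
    using has_derivative_gradient[OF assms] by simp
  have "((\<lambda>s. x + s *\<^sub>R v) has_derivative (\<lambda>s. s *\<^sub>R v)) (at (0::real))"
    by (auto intro!: derivative_eq_intros)
  from has_derivative_compose[OF this g]
  show ?thesis by (rule has_derivative_imp_has_field_derivative) simp
qed

text \<open>A pointwise limit of measurable difference quotients; the derivative itself may be
  discontinuous.\<close>

lemma borel_measurable_directional_derivative:
  fixes g :: "'a::euclidean_space \<Rightarrow> real"
  assumes [measurable]: "g \<in> borel_measurable borel"
    and d: "\<And>x. ((\<lambda>s. g (x + s *\<^sub>R v)) has_real_derivative g' x) (at 0)"
  shows "g' \<in> borel_measurable borel"
proof (rule borel_measurable_LIMSEQ_real)
  fix x
  have "((\<lambda>h. (g (x + h *\<^sub>R v) - g x) / h) \<longlongrightarrow> g' x) (at 0)"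
    using d[of x] by (simp add: has_field_derivative_iff)
  moreover have "filterlim (\<lambda>n. 1 / real (Suc n)) (at 0) sequentially"
    by (intro filterlim_atI LIMSEQ_Suc lim_1_over_n) auto
  ultimately show "(\<lambda>n. (g (x + (1 / real (Suc n)) *\<^sub>R v) - g x) / (1 / real (Suc n))) \<longlonglongrightarrow> g' x"
    by (rule filterlim_compose)
qed measurable

lemma outer_product_quadratic: "v \<bullet> (outer_product a a *v v) = (v \<bullet> a)\<^sup>2" for v a :: "real^'n"
proof -
  have "v \<bullet> (outer_product a a *v v) = (\<Sum>i\<in>UNIV. \<Sum>j\<in>UNIV. (v $ i * a $ i) * (v $ j * a $ j))"
    by (simp add: inner_vec_def outer_product_def matrix_vector_mult_def sum_distrib_left mult_ac)
  also have "\<dots> = (v \<bullet> a)\<^sup>2"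
    by (simp add: inner_vec_def power2_eq_square sum_product)
  finally show ?thesis .
qed

lemma bounded_linear_quadratic_form: "bounded_linear (\<lambda>A :: real^'n^'n. v \<bullet> (A *v v))"
  by (intro linear_conv_bounded_linear[THEN iffD1] linearI)
    (simp_all add: matrix_vector_mult_add_rdistrib scaleR_matrix_vector_assoc[symmetric] inner_add_right)

lemma transpose_integral:
  fixes g :: "'b \<Rightarrow> real^'n^'n"
  assumes "\<And>x. transpose (g x) = g x"
  shows "transpose (integral\<^sup>L N g) = integral\<^sup>L N g"
proof (cases "integrable N g")
  case True
  have comp: "(integral\<^sup>L N g) $ i $ j = (\<integral>x. g x $ i $ j \<partial>N)" for i j
    using True by (simp add: integral_bounded_linear[OF bounded_linear_compose[OF bounded_linear_vec_nth bounded_linear_vec_nth]])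
  have "g x $ i $ j = g x $ j $ i" for x i j
    using arg_cong[OF assms[of x], of "\<lambda>A. A $ i $ j"] by (simp add: transpose_def)
  then show ?thesis by (simp add: vec_eq_iff transpose_def comp)
next
  case False
  then show ?thesis by (simp add: not_integrable_integral_eq transpose_def vec_eq_iff)
qed

lemma tendsto_det_add_scaled_identity:
  fixes J :: "real^'n^'n"
  shows "((\<lambda>\<epsilon>. det (J + \<epsilon> *\<^sub>R mat 1)) \<longlongrightarrow> det J) (at_right 0)"
proof -
  have "((\<lambda>\<epsilon>. det (J + \<epsilon> *\<^sub>R mat 1)) \<longlongrightarrow> det (J + 0 *\<^sub>R mat 1)) (at_right 0)"
    unfolding det_def by (intro tendsto_intros)
  then show ?thesis by simp
qed

section \<open>The Fisher information of the joint density\<close>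

context gaussian_observation
begin

definition "info = prior_info p0 + data_info p0 F S u"

context
  assumes reg: "information_regularity \<Theta> p0 F S u"
begin

lemma p0_differentiable: "p0 differentiable (at t)"
  and f_differentiable: "(\<lambda>s. f (s, y)) differentiable (at t)"
  and mean_score_zero: "t \<in> \<Theta> \<Longrightarrow> has_bochner_integral lborel (\<lambda>y. gradient (\<lambda>s. lik s y) t) 0"
  and prior_info_integrable: "integrable lborel (prior_info_integrand p0)"
  and data_info_integrable: "integrable (lborel \<Otimes>\<^sub>M lborel) (data_info_integrand p0 F S u)"
  using reg by (auto simp: information_regularity_def f_def)

text \<open>The regularity conditions give derivatives of the prior and of the joint density. Near a
  point with \<open>0 < p0 t\<close> the prior stays positive by continuity, and the likelihood is
  their quotient.\<close>

lemma lik_differentiable: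
  assumes t: "0 < p0 t"
  shows "(\<lambda>s. lik s y) differentiable (at t)"
proof -
  have cont: "isCont p0 t"
    using p0_differentiable by (rule differentiable_imp_continuous_within)
  then have ev: "eventually (\<lambda>s. 0 < p0 s) (nhds t)"
    using t by (metis continuous_at_imp_continuous_at_within eventually_nhds order_tendstoD(1) isCont_def tendsto_nhds_iff at_within_open)
  have "(\<lambda>s. f (s, y) / p0 s) differentiable (at t)"
    using f_differentiable p0_differentiable t by (intro differentiable_divide) auto
  then obtain D where "((\<lambda>s. f (s, y) / p0 s) has_derivative D) (at t)"
    by (auto simp: differentiable_def)
  then have "((\<lambda>s. lik s y) has_derivative D) (at t)"
    by (rule has_derivative_transform_eventually)
      (use ev t in \<open>auto simp: eventually_at_filter f_eq elim: eventually_mono\<close>)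
  then show ?thesis by (auto simp: differentiable_def)
qed

definition f' :: "real^'n \<Rightarrow> (real^'n) \<times> (real^'m) \<Rightarrow> real" where
  "f' v x = v \<bullet> gradient (\<lambda>s. f (s, snd x)) (fst x)"

lemma f'_deriv: "((\<lambda>s. f (x + s *\<^sub>R (v, 0))) has_real_derivative f' v x) (at 0)"
  using DERIV_gradient_line[OF f_differentiable, of "fst x" v "snd x"]
  by (cases x) (simp add: f'_def)

lemma f'_measurable [measurable]: "f' v \<in> borel_measurable borel"
  by (rule borel_measurable_directional_derivative[OF f_measurable f'_deriv])

definition \<alpha> :: "real^'n \<Rightarrow> real^'n \<Rightarrow> real" where
  "\<alpha> v t = (v \<bullet> gradient p0 t) / p0 t"

lemma \<alpha>_measurable [measurable]: "\<alpha> v \<in> borel_measurable borel"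
proof -
  have [measurable]: "(\<lambda>t. v \<bullet> gradient p0 t) \<in> borel_measurable borel"
    by (rule borel_measurable_directional_derivative[OF p0_measurable DERIV_gradient_line])
      (rule p0_differentiable)
  show ?thesis unfolding \<alpha>_def by measurable
qed

text \<open>The likelihood score in direction \<open>v\<close>, as \<open>\<beta>_eq\<close> shows.
  It is written as joint score minus prior score because these two are known to be
  measurable.\<close>

definition \<beta> :: "real^'n \<Rightarrow> (real^'n) \<times> (real^'m) \<Rightarrow> real" where
  "\<beta> v x = (if f x = 0 then 0 else f' v x / f x - \<alpha> v (fst x))"

lemma \<beta>_measurable [measurable]: "\<beta> v \<in> borel_measurable (borel \<Otimes>\<^sub>M borel)"
proof -
  have [measurable]: "f' v \<in> borel_measurable (borel \<Otimes>\<^sub>M borel)"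
    unfolding borel_prod by measurable
  show ?thesis unfolding \<beta>_def by measurable
qed

lemma f_pos_iff: "0 < f (t, y) \<longleftrightarrow> 0 < p0 t"
proof
  show "0 < p0 t" if "0 < f (t, y)"
    using that p0_nonneg[of t] by (cases "p0 t = 0") (auto simp: f_eq)
  show "0 < f (t, y)" if "0 < p0 t"
  proof -
    have "t \<in> \<Theta>" using that p0_outside[of t] by force
    then show ?thesis using that lik_pos by (simp add: f_eq)
  qed
qed

lemma \<beta>_eq:
  assumes t: "0 < p0 t"
  shows "\<beta> v (t, y) = (v \<bullet> gradient (\<lambda>s. lik s y) t) / lik t y"
proof -
  have "0 < f (t, y)" using t by (simp add: f_pos_iff)
  then have l: "0 < lik t y" using t lik_nonneg[of t y] by (auto simp: f_eq zero_less_mult_iff)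
  have "f' v (t, y) = p0 t * (v \<bullet> gradient (\<lambda>s. lik s y) t) + lik t y * (v \<bullet> gradient p0 t)"
    using gradient_mult[OF p0_differentiable[of t] lik_differentiable[OF t]]
    by (simp add: f'_def f_eq inner_add_right)
  then show ?thesis
    using t l by (simp add: \<beta>_def \<alpha>_def f_eq add_divide_distrib)
qed

lemma prior_quadratic: "v \<bullet> (prior_info_integrand p0 t *v v) = p0 t * (\<alpha> v t)\<^sup>2"
proof (cases "p0 t = 0")
  case False
  then have "0 < p0 t" using p0_nonneg[of t] by simp
  then show ?thesis
    by (simp add: prior_info_integrand_def scaleR_matrix_vector_assoc[symmetric] outer_product_quadratic
        gradient_ln[OF p0_differentiable] \<alpha>_def divide_inverse mult.commute)
qed (simp add: prior_info_integrand_def)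

lemma data_quadratic: "v \<bullet> (data_info_integrand p0 F S u x *v v) = f x * (\<beta> v x)\<^sup>2"
proof (cases x)
  case (Pair t y)
  show ?thesis
  proof (cases "p0 t = 0")
    case True
    then show ?thesis by (simp add: Pair data_info_integrand_def joint_density_def f_eq)
  next
    case False
    then have t: "0 < p0 t" using p0_nonneg[of t] by simp
    then have "0 < lik t y" using lik_nonneg[of t y] f_pos_iff[of t y] by (auto simp: f_eq zero_less_mult_iff)
    then show ?thesis
      using t by (simp add: Pair data_info_integrand_def scaleR_matrix_vector_assoc[symmetric] outer_product_quadratic
          gradient_ln[OF lik_differentiable] \<beta>_eq divide_inverse mult.commute f_def)
  qed
qed

text \<open>Evaluating the quadratic form at \<open>v\<close> is bounded linear in the matrix, so
  matrix integrals become integrals of squared scores.\<close>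

lemma prior_info_quadratic:
  "integrable lborel (\<lambda>t. p0 t * (\<alpha> v t)\<^sup>2)"
  "v \<bullet> (prior_info p0 *v v) = (\<integral>t. p0 t * (\<alpha> v t)\<^sup>2 \<partial>lborel)"
  using integrable_bounded_linear[OF bounded_linear_quadratic_form prior_info_integrable, of v]
    integral_bounded_linear[OF bounded_linear_quadratic_form prior_info_integrable, of v]
  by (simp_all add: prior_quadratic prior_info_def)

lemma data_info_quadratic:
  "integrable lborel (\<lambda>x. f x * (\<beta> v x)\<^sup>2)"
  "v \<bullet> (data_info p0 F S u *v v) = (\<integral>x. f x * (\<beta> v x)\<^sup>2 \<partial>lborel)"
  using integrable_bounded_linear[OF bounded_linear_quadratic_form data_info_integrable, of v]
    integral_bounded_linear[OF bounded_linear_quadratic_form data_info_integrable, of v]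
  by (simp_all add: data_quadratic data_info_def lborel_prod)

text \<open>Both sides are densities of the law of \<theta>, so uniqueness of densities replaces the
  evaluation of a multivariate Gaussian integral.\<close>

lemma marginal_prior: "AE t in lborel. (\<integral>\<^sup>+ y. ennreal (f (t, y)) \<partial>lborel) = ennreal (p0 t)"
proof -
  have "density lborel (\<lambda>t. \<integral>\<^sup>+ y. ennreal (f (t, y)) \<partial>lborel) = density lborel (\<lambda>t. ennreal (p0 t))"
  proof (rule measure_eqI)
    fix X :: "(real^'n) set" assume "X \<in> sets (density lborel (\<lambda>t. \<integral>\<^sup>+ y. ennreal (f (t, y)) \<partial>lborel))"
    then have [measurable]: "X \<in> sets borel" by simp
    have "(\<integral>\<^sup>+ t. (\<integral>\<^sup>+ y. ennreal (f (t, y)) \<partial>lborel) * indicator X t \<partial>lborel)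
        = (\<integral>\<^sup>+ t. (\<integral>\<^sup>+ y. ennreal (f (t, y)) * indicator X t \<partial>lborel) \<partial>lborel)"
      by (simp add: nn_integral_multc)
    also have "\<dots> = (\<integral>\<^sup>+ x. ennreal (f x) * indicator X (fst x) \<partial>(lborel \<Otimes>\<^sub>M lborel))"
      by (subst lborel.nn_integral_fst[symmetric]) auto
    also have "\<dots> = (\<integral>\<^sup>+ \<omega>. indicator X (\<theta> \<omega>) \<partial>M)"
      using nn_integral_joint[of "\<lambda>x. indicator X (fst x)"] by simp
    also have "\<dots> = (\<integral>\<^sup>+ t. ennreal (p0 t) * indicator X t \<partial>lborel)"
      by (rule distributed_nn_integral[OF \<theta>_distributed, symmetric]) measurable
    finally show "emeasure (density lborel (\<lambda>t. \<integral>\<^sup>+ y. ennreal (f (t, y)) \<partial>lborel)) X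
        = emeasure (density lborel (\<lambda>t. ennreal (p0 t))) X"
      by (simp add: emeasure_density)
  qed simp
  then show ?thesis
    by (subst (asm) sigma_finite_measure.density_unique_iff[OF sigma_finite_lborel]) auto
qed

lemma f_\<alpha>_integral:
  "integrable lborel (\<lambda>x. f x * (\<alpha> v (fst x))\<^sup>2)"
  "(\<integral>x. f x * (\<alpha> v (fst x))\<^sup>2 \<partial>lborel) = (\<integral>t. p0 t * (\<alpha> v t)\<^sup>2 \<partial>lborel)"
proof -
  have [measurable]: "(\<lambda>x. f x * (\<alpha> v (fst x))\<^sup>2) \<in> borel_measurable borel"
    unfolding borel_prod[symmetric] by measurable
  have "(\<integral>\<^sup>+ x. ennreal (f x * (\<alpha> v (fst x))\<^sup>2) \<partial>(lborel \<Otimes>\<^sub>M lborel))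
      = (\<integral>\<^sup>+ t. (\<integral>\<^sup>+ y. ennreal (f (t, y)) * ennreal ((\<alpha> v t)\<^sup>2) \<partial>lborel) \<partial>lborel)"
    by (subst lborel.nn_integral_fst[symmetric]) (auto simp: ennreal_mult f_nonneg)
  also have "\<dots> = (\<integral>\<^sup>+ t. (\<integral>\<^sup>+ y. ennreal (f (t, y)) \<partial>lborel) * ennreal ((\<alpha> v t)\<^sup>2) \<partial>lborel)"
    by (simp add: nn_integral_multc)
  also have "\<dots> = (\<integral>\<^sup>+ t. ennreal (p0 t * (\<alpha> v t)\<^sup>2) \<partial>lborel)"
    by (rule nn_integral_cong_AE)
      (use marginal_prior in eventually_elim, simp add: ennreal_mult p0_nonneg)
  also have "\<dots> = ennreal (\<integral>t. p0 t * (\<alpha> v t)\<^sup>2 \<partial>lborel)"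
    using prior_info_quadratic(1) p0_nonneg by (intro nn_integral_eq_integral) auto
  finally have *: "(\<integral>\<^sup>+ x. ennreal (f x * (\<alpha> v (fst x))\<^sup>2) \<partial>lborel) = ennreal (\<integral>t. p0 t * (\<alpha> v t)\<^sup>2 \<partial>lborel)"
    by (simp add: lborel_prod)
  show "integrable lborel (\<lambda>x. f x * (\<alpha> v (fst x))\<^sup>2)"
    using * f_nonneg by (intro integrableI_nonneg) auto
  show "(\<integral>x. f x * (\<alpha> v (fst x))\<^sup>2 \<partial>lborel) = (\<integral>t. p0 t * (\<alpha> v t)\<^sup>2 \<partial>lborel)"
    using * f_nonneg p0_nonneg by (subst integral_eq_nn_integral) (auto simp: integral_nonneg_AE)
qed

text \<open>For a fixed parameter the prior score is constant and \<open>f\<close> times \<beta> is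
  \<open>p0 t\<close> times a derivative of the likelihood, which integrates to 0 by
  \<open>mean_score_zero\<close>. The integrability that Fubini needs comes from the squares of the
  two scores.\<close>

lemma f_\<alpha>\<beta>_integral:
  "integrable lborel (\<lambda>x. f x * (\<alpha> v (fst x) * \<beta> v x))"
  "(\<integral>x. f x * (\<alpha> v (fst x) * \<beta> v x) \<partial>lborel) = 0"
proof -
  let ?c = "\<lambda>x. f x * (\<alpha> v (fst x) * \<beta> v x)"
  have [measurable]: "?c \<in> borel_measurable borel"
    unfolding borel_prod[symmetric] by measurable
  show int: "integrable lborel ?c"
  proof (rule Bochner_Integration.integrable_bound)
    show "integrable lborel (\<lambda>x. f x * (\<alpha> v (fst x))\<^sup>2 + f x * (\<beta> v x)\<^sup>2)"
      using f_\<alpha>_integral(1) data_info_quadratic(1) by (rule Bochner_Integration.integrable_add)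
    have "\<bar>a * b\<bar> \<le> a\<^sup>2 + b\<^sup>2" for a b :: real
    proof -
      have "2 * \<bar>a * b\<bar> \<le> a\<^sup>2 + b\<^sup>2"
        using sum_squares_bound[of "\<bar>a\<bar>" "\<bar>b\<bar>"] by (simp add: abs_mult mult.assoc)
      then show ?thesis using abs_ge_zero[of "a * b"] by linarith
    qed
    note ab = this
    have "norm (?c x) \<le> norm (f x * (\<alpha> v (fst x))\<^sup>2 + f x * (\<beta> v x)\<^sup>2)" for x
    proof -
      have "norm (?c x) = f x * \<bar>\<alpha> v (fst x) * \<beta> v x\<bar>"
        using f_nonneg[of x] by (simp only: real_norm_def abs_mult abs_of_nonneg)
      also have "\<dots> \<le> f x * ((\<alpha> v (fst x))\<^sup>2 + (\<beta> v x)\<^sup>2)"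
        using f_nonneg by (intro mult_left_mono ab)
      also have "\<dots> \<le> norm (f x * (\<alpha> v (fst x))\<^sup>2 + f x * (\<beta> v x)\<^sup>2)"
        by (simp add: distrib_left)
      finally show ?thesis .
    qed
    then show "AE x in lborel. norm (?c x) \<le> norm (f x * (\<alpha> v (fst x))\<^sup>2 + f x * (\<beta> v x)\<^sup>2)" by simp
  qed simp
  have inner: "(\<integral>y. ?c (t, y) \<partial>lborel) = 0" for t
  proof (cases "p0 t = 0")
    case True
    then show ?thesis by (simp add: f_eq)
  next
    case False
    then have t: "0 < p0 t" using p0_nonneg[of t] by simp
    then have "t \<in> \<Theta>" using p0_outside[of t] by force
    have c: "?c (t, y) = (p0 t * \<alpha> v t) * (v \<bullet> gradient (\<lambda>s. lik s y) t)" for y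
      using lik_pos[OF \<open>t \<in> \<Theta>\<close>, of y] by (simp add: f_eq \<beta>_eq[OF t])
    have z: "(\<integral>y. v \<bullet> gradient (\<lambda>s. lik s y) t \<partial>lborel) = 0"
      using has_bochner_integral_inner_right[of v, OF mean_score_zero[OF \<open>t \<in> \<Theta>\<close>]]
      by (simp add: has_bochner_integral_integral_eq)
    show ?thesis by (simp only: c integral_mult_right_zero z mult_zero_right)
  qed
  have "(\<integral>x. ?c x \<partial>(lborel \<Otimes>\<^sub>M lborel)) = (\<integral>t. (\<integral>y. ?c (t, y) \<partial>lborel) \<partial>lborel)"
    by (rule lborel_pair.integral_fst'[symmetric]) (use int in \<open>simp add: lborel_prod\<close>)
  then show "(\<integral>x. ?c x \<partial>lborel) = 0"
    unfolding inner by (simp add: lborel_prod)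
qed

text \<open>Where \<open>f\<close> is positive the joint score is the sum of the two scores, and the
  cross term of its square integrates to 0. At zeros of \<open>f\<close> both sides of
  \<open>eq\<close> are 0.\<close>

lemma joint_information:
  "integrable lborel (\<lambda>x. (f' v x)\<^sup>2 / f x)"
  "(\<integral>x. (f' v x)\<^sup>2 / f x \<partial>lborel) = v \<bullet> (info *v v)"
proof -
  have eq: "(f' v x)\<^sup>2 / f x = f x * (\<alpha> v (fst x))\<^sup>2 + 2 * (f x * (\<alpha> v (fst x) * \<beta> v x)) + f x * (\<beta> v x)\<^sup>2" for x
  proof (cases "f x = 0")
    case False
    then have "f' v x = f x * (\<alpha> v (fst x) + \<beta> v x)" by (simp add: \<beta>_def)
    then show ?thesis using False by (simp add: power2_eq_square field_simps)
  qed simp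
  show "integrable lborel (\<lambda>x. (f' v x)\<^sup>2 / f x)"
    unfolding eq using f_\<alpha>_integral(1) f_\<alpha>\<beta>_integral(1) data_info_quadratic(1)
    by (intro Bochner_Integration.integrable_add integrable_mult_right)
  have "(\<integral>x. (f' v x)\<^sup>2 / f x \<partial>lborel) = (\<integral>x. f x * (\<alpha> v (fst x))\<^sup>2 \<partial>lborel)
      + 2 * (\<integral>x. f x * (\<alpha> v (fst x) * \<beta> v x) \<partial>lborel) + (\<integral>x. f x * (\<beta> v x)\<^sup>2 \<partial>lborel)"
    unfolding eq using f_\<alpha>_integral(1) f_\<alpha>\<beta>_integral(1) data_info_quadratic(1)
    by (simp add: Bochner_Integration.integral_add)
  then show "(\<integral>x. (f' v x)\<^sup>2 / f x \<partial>lborel) = v \<bullet> (info *v v)"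
    by (simp add: f_\<alpha>_integral(2) f_\<alpha>\<beta>_integral(2) prior_info_quadratic(2) data_info_quadratic(2)
        info_def matrix_vector_mult_add_rdistrib inner_add_right)
qed

lemma info_symmetric: "transpose info = info"
proof -
  have "transpose (c *\<^sub>R outer_product a a) = c *\<^sub>R outer_product a a" for c and a :: "real^'n"
    by (simp add: transpose_def outer_product_def vec_eq_iff mult.commute)
  then have "transpose (prior_info p0) = prior_info p0" "transpose (data_info p0 F S u) = data_info p0 F S u"
    unfolding prior_info_def data_info_def
    by (auto intro!: transpose_integral simp: prior_info_integrand_def data_info_integrand_def split: prod.split)
  then show ?thesis by (simp add: info_def transpose_def vec_eq_iff)
qed

lemma info_psd: "0 \<le> v \<bullet> (info *v v)"
  unfolding joint_information(2)[symmetric] using f_nonneg by (intro integral_nonneg_AE) auto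

lemma line_density_f: "line_density f (f' v) (v, 0)"
  by unfold_locales (rule f_nonneg f_measurable f'_measurable f'_deriv f_total)+

text \<open>Adding a small multiple of the identity makes the information matrix positive definite without
  assuming it invertible; the lower bound obtained for the determinant does not depend on it.\<close>

lemma det_information_ge:
  "exp (real CARD('n) * ln (2 * pi * exp 1) - 2 * posterior_entropy M \<theta> Y p0 F S u) \<le> det info"
proof (rule tendsto_lowerbound[OF tendsto_det_add_scaled_identity])
  let ?h = "posterior_entropy M \<theta> Y p0 F S u"
  have "exp (real CARD('n) * ln (2 * pi * exp 1) - 2 * ?h) \<le> det (info + \<epsilon> *\<^sub>R mat 1)" if \<epsilon>: "0 < \<epsilon>" for \<epsilon>
  proof -
    let ?K = "info + \<epsilon> *\<^sub>R mat 1"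
    have quad: "v \<bullet> (?K *v v) = v \<bullet> (info *v v) + \<epsilon> * (v \<bullet> v)" for v
      by (simp add: matrix_vector_mult_add_rdistrib scaleR_matrix_vector_assoc[symmetric] inner_add_right)
    have K: "sym_pos_def ?K"
      unfolding sym_pos_def_def
    proof (intro conjI allI impI)
      have "info $ j $ i = info $ i $ j" for i j
        using arg_cong[OF info_symmetric, of "\<lambda>A. A $ i $ j"] by (simp add: transpose_def)
      then show "transpose ?K = ?K" by (auto simp: transpose_def vec_eq_iff mat_def)
      show "0 < v \<bullet> (?K *v v)" if "v \<noteq> 0" for v
        using info_psd[of v] \<epsilon> that unfolding quad by (intro add_nonneg_pos mult_pos_pos) auto
    qed
    note bound = conditional_entropy_lower_bound[of f f' ?K, OF line_density_f joint_information(1) _ K]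
    have le: "(\<integral>x. (f' v x)\<^sup>2 / f x \<partial>lborel) \<le> v \<bullet> (?K *v v)" for v
      unfolding quad using \<epsilon> by (simp add: joint_information(2))
    have ent: "integrable lborel (\<lambda>x. f x * ln (f x / enn2real (\<integral>\<^sup>+ t. ennreal (f (t, snd x)) \<partial>lborel)))"
      using posterior_integrable by (simp add: evidence_eq)
    have "0 < det ?K" using bound(1)[OF le ent] .
    moreover have "- ?h \<le> ln (det ?K) / 2 - real CARD('n) / 2 * ln (2 * pi * exp 1)"
      using bound(2)[OF le ent] by (simp add: posterior_entropy_eq evidence_eq)
    then have "real CARD('n) * ln (2 * pi * exp 1) - 2 * ?h \<le> ln (det ?K)" by simp
    ultimately show ?thesis by (simp add: ln_ge_iff)
  qed
  then show "eventually (\<lambda>\<epsilon>. exp (real CARD('n) * ln (2 * pi * exp 1) - 2 * ?h) \<le> det (info + \<epsilon> *\<^sub>R mat 1)) (at_right 0)"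
    by (intro eventually_at_right_less[THEN eventually_mono]) auto
qed simp

text \<open>Take \<open>n\<close>-th roots in \<open>det_information_ge\<close> and invert. Since
  the determinant is shown to be positive, the quotient is not a default value of division.\<close>

lemma information_bound:
  defines "n \<equiv> real CARD('n)"
  shows "0 < det info"
    and "n / det info powr (1 / n) \<le> n * inverse (2 * pi * exp 1) * exp (2 / n * posterior_entropy M \<theta> Y p0 F S u)"
proof -
  let ?h = "posterior_entropy M \<theta> Y p0 F S u"
  have n: "0 < n" by (simp add: n_def)
  have ge: "exp (n * ln (2 * pi * exp 1) - 2 * ?h) \<le> det info"
    unfolding n_def by (rule det_information_ge)
  then show pos: "0 < det info" by (rule less_le_trans[OF exp_gt_zero])
  have "exp (ln (2 * pi * exp 1) - 2 / n * ?h) = exp (n * ln (2 * pi * exp 1) - 2 * ?h) powr (1 / n)"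
    using n by (simp add: powr_def diff_divide_distrib)
  also have "\<dots> \<le> det info powr (1 / n)"
    using ge n by (intro powr_mono2) auto
  finally have "n / det info powr (1 / n) \<le> n / exp (ln (2 * pi * exp 1) - 2 / n * ?h)"
    using n pos by (intro divide_left_mono) auto
  also have "\<dots> = n * inverse (2 * pi * exp 1) * exp (2 / n * ?h)"
    by (simp add: exp_diff field_simps)
  finally show "n / det info powr (1 / n) \<le> n * inverse (2 * pi * exp 1) * exp (2 / n * ?h)" .
qed

end

end

theorem theorem1:
  fixes M :: "'a measure"
    and \<Theta> :: "(real^'n) set"
    and p0 :: "real^'n \<Rightarrow> real"
    and u :: "real^'k"
    and F :: "real^'n \<Rightarrow> real^'k \<Rightarrow> real^'m"
    and S :: "real^'n \<Rightarrow> real^'k \<Rightarrow> real^'m^'m"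
    and \<theta> :: "'a \<Rightarrow> real^'n"
    and Z Y :: "'a \<Rightarrow> real^'m"
    and est :: "real^'m \<Rightarrow> real^'k \<Rightarrow> real^'n"
  assumes "prob_space M"
    and "\<And>\<omega>. \<omega> \<in> space M \<Longrightarrow> \<theta> \<omega> \<in> \<Theta>"
    and "\<And>t. 0 \<le> p0 t"
    and "\<And>t. t \<notin> \<Theta> \<Longrightarrow> p0 t = 0"
    and "distributed M lborel \<theta> (\<lambda>t. ennreal (p0 t))"
    and "smooth_near (\<Theta> \<times> UNIV) (\<lambda>(t, v). F t v)"
    and "smooth_near (\<Theta> \<times> UNIV) (\<lambda>(t, v). S t v)"
    and "\<And>t v. t \<in> \<Theta> \<Longrightarrow> sym_pos_def (S t v)"
    and "distributed M (lborel \<Otimes>\<^sub>M lborel) (\<lambda>\<omega>. (\<theta> \<omega>, Z \<omega>))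
           (\<lambda>(t, z). ennreal (p0 t * gaussian_density z 0 (S t u)))"
    and "\<And>\<omega>. \<omega> \<in> space M \<Longrightarrow> Y \<omega> = F (\<theta> \<omega>) u + Z \<omega>"
    and "finite_entropies M \<theta> Y p0 F S u"
    and "(\<lambda>y. est y u) \<in> borel_measurable borel"
  defines "n \<equiv> real CARD('n)"
    and "H \<equiv> prior_entropy M \<theta> p0"
    and "I \<equiv> mutual_info M \<theta> Y p0 F S u"
    and "J \<equiv> prior_info p0 + data_info p0 F S u"
  shows "ennreal (n * inverse (2 * pi * exp 1) * exp (2 / n * (H - I)))
           \<le> (\<integral>\<^sup>+\<omega>. ennreal ((norm (\<theta> \<omega> - est (Y \<omega>) u))\<^sup>2) \<partial>M)
       \<and> (information_regularity \<Theta> p0 F S u \<longrightarrow>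
            0 < det J \<and>
            n / det J powr (1 / n) \<le> n * inverse (2 * pi * exp 1) * exp (2 / n * (H - I)))"
proof -
  interpret gaussian_observation M \<Theta> p0 u F S \<theta> Z Y
    by (intro gaussian_observation.intro) (use assms in auto)
  have HI: "H - I = posterior_entropy M \<theta> Y p0 F S u"
    by (simp add: H_def I_def mutual_info_def)
  have J: "J = info"
    by (simp add: J_def info_def)
  show ?thesis
    unfolding HI
    using mse_lower_bound[OF assms(12)] information_bound J by (auto simp: n_def)
qed

end
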